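(* Let $f_n:\{0,1\}^{V_n}\to\{-1,1\}$, $n\in\mathbb{N}$, be a sequence of functions. 1. If, for some choice of sequence $\{G_n,\alpha_n\}_{n\in\mathbb{N}}$ (with $G_n=(V_n,E_n)$ and $0<\alpha_n\le 1/d(G_n)$), the sequence $\{f_n\}$ is XS with respect to $\{G_n,\alpha_n\}_{n\in\mathbb{N}}$, then $\{f_n\}$ is NS. 2. If $\{f_n\}$ is NStable, then $\{f_n\}$ is XStable with respect to any $\{G_n,\alpha_n\}_{n\in\mathbb{N}}$ (with $G_n=(V_n,E_n)$ and $0<\alpha_n\le 1/d(G_n)$).
   Context: $\{V_n\}$ is an increasing sequence of finite sets, $G_n=(V_n,E_n)$ is an increasing sequence of finite graphs, and $d(G_n)$ is the maximum degree of $G_n$. Let $\omega$ be uniform on $\{0,1\}^{V_n}$; for $\epsilon\in(0,1)$, $\omega^\epsilon$ is obtained from $\omega$ by resampling each coordinate (as a fair bit) independently with probability $\epsilon$. NS (noise sensitive): for every $\epsilon\in(0,1)$, $\lim_{n\to\infty}\mathbb{E}[f_n(\omega)f_n(\omega^\epsilon)]-\mathbb{E}[f_n(\omega)]^2=0$. NStable (noise stable): for every $\delta>0$ there is $\epsilon>0$ such that for every $n$, $\mathbb{P}[f_n(\omega)\ne f_n(\omega^\epsilon)]\le\delta$. Symmetric exclusion process on $(G_n,\alpha_n)$: to every edge $e\in E_n$ associate an independent Poisson clock of rate $\alpha_n$; when it rings, the endpoints of $e$ are interchanged. $\pi^n_t$ is the random permutation of $V_n$ obtained by composing, in order, all transpositions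 up to time $t$. With $\eta^n_0$ uniform on $\{0,1\}^{V_n}$ and independent of the clocks, $\eta^n_t(x)=\eta^n_0((\pi^n_t)^{-1}(x))$. XS with respect to $\{G_n,\alpha_n\}$: for some $t>0$ (equivalently, for all $t>0$), $\lim_{n\to\infty}\mathbb{E}[f_n(\eta^n_0)f_n(\eta^n_t)]-\mathbb{E}[f_n(\eta^n_0)]^2=0$. XStable with respect to $\{G_n,\alpha_n\}$: for every $\delta>0$ there is $t>0$ such that for every $n$, $\mathbb{P}[f_n(\eta^n_0)\ne f_n(\eta^n_t)]\le\delta$. *)

theory Defs
  imports "HOL-Probability.Probability" "HOL-Combinatorics.Transposition"
begin

section \<open>Configurations and resampling noise\<close>

text \<open>
  An element of \<open>{0,1}\<^sup>V\<close> is a boolean function on \<open>V\<close>, extended by \<open>undefined\<close> outside \<open>V\<close>.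
\<close>

definition configs :: "'a set \<Rightarrow> ('a \<Rightarrow> bool) set" where
  "configs V = V \<rightarrow>\<^sub>E UNIV"

text \<open>
  Joint law of \<open>(\<omega>, \<omega>\<^sup>\<epsilon>)\<close>: the coordinates marked by \<open>r\<close> are replaced by the fresh fair bits \<open>\<xi>\<close>.
\<close>

definition noisy_pair :: "'a set \<Rightarrow> real \<Rightarrow> (('a \<Rightarrow> bool) \<times> ('a \<Rightarrow> bool)) pmf" where
  "noisy_pair V \<epsilon> =
     do {
       \<omega> \<leftarrow> pmf_of_set (configs V);
       r \<leftarrow> Pi_pmf V False (\<lambda>_. bernoulli_pmf \<epsilon>);
       \<xi> \<leftarrow> pmf_of_set (configs V);
       return_pmf (\<omega>, \<lambda>x\<in>V. if r x then \<xi> x else \<omega> x)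
     }"

definition NS :: "(nat \<Rightarrow> 'a set) \<Rightarrow> (nat \<Rightarrow> ('a \<Rightarrow> bool) \<Rightarrow> real) \<Rightarrow> bool" where
  "NS V f \<longleftrightarrow> (\<forall>\<epsilon>. 0 < \<epsilon> \<and> \<epsilon> < 1 \<longrightarrow>
     (\<lambda>n. measure_pmf.expectation (noisy_pair (V n) \<epsilon>) (\<lambda>(\<omega>, \<omega>'). f n \<omega> * f n \<omega>')
          - (measure_pmf.expectation (pmf_of_set (configs (V n))) (f n))\<^sup>2) \<longlonglongrightarrow> 0)"

definition NStable :: "(nat \<Rightarrow> 'a set) \<Rightarrow> (nat \<Rightarrow> ('a \<Rightarrow> bool) \<Rightarrow> real) \<Rightarrow> bool" where
  "NStable V f \<longleftrightarrow> (\<forall>\<delta>>0. \<exists>\<epsilon>. 0 < \<epsilon> \<and> \<epsilon> < 1 \<and>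
     (\<forall>n. measure_pmf.prob (noisy_pair (V n) \<epsilon>) {(\<omega>, \<omega>'). f n \<omega> \<noteq> f n \<omega>'} \<le> \<delta>))"

section \<open>Graphs and rates\<close>

definition finite_graph :: "'a set \<Rightarrow> 'a set set \<Rightarrow> bool" where
  "finite_graph V E \<longleftrightarrow> finite V \<and> (\<forall>e\<in>E. \<exists>a\<in>V. \<exists>b\<in>V. a \<noteq> b \<and> e = {a, b})"

definition max_degree :: "'a set \<Rightarrow> 'a set set \<Rightarrow> nat" where
  "max_degree V E = Max (insert 0 ((\<lambda>v. card {e \<in> E. v \<in> e}) ` V))"

text \<open>
  For a graph without edges the bound \<open>1 / d(G)\<close> is read as \<open>\<infinity>\<close> (and not as \<open>1 / 0 = 0\<close>),
  so that every positive rate is admissible.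
\<close>

definition admissible :: "(nat \<Rightarrow> 'a set) \<Rightarrow> (nat \<Rightarrow> 'a set set) \<Rightarrow> (nat \<Rightarrow> real) \<Rightarrow> bool" where
  "admissible V E \<alpha> \<longleftrightarrow> incseq V \<and> incseq E \<and>
     (\<forall>n. finite_graph (V n) (E n) \<and> 0 < \<alpha> n \<and>
          (max_degree (V n) (E n) \<noteq> 0 \<longrightarrow> \<alpha> n \<le> 1 / real (max_degree (V n) (E n))))"

section \<open>Poisson clocks\<close>

text \<open>
  A clock is given by its random set \<open>T \<omega>\<close> of ringing times; \<open>rings T t\<close> counts the rings up to
  time \<open>t\<close>. It is a Poisson clock if the counting process has independent Poisson increments.
\<close>

definition rings :: "('w \<Rightarrow> real set) \<Rightarrow> real \<Rightarrow> 'w \<Rightarrow> nat" where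
  "rings T t \<omega> = card (T \<omega> \<inter> {..t})"

definition poisson_clock :: "'w measure \<Rightarrow> real \<Rightarrow> ('w \<Rightarrow> real set) \<Rightarrow> bool" where
  "poisson_clock M \<rho> T \<longleftrightarrow>
     (\<forall>\<omega>\<in>space M. T \<omega> \<subseteq> {0<..} \<and> (\<forall>t. finite (T \<omega> \<inter> {..t}))) \<and>
     (\<forall>s t. 0 \<le> s \<and> s < t \<longrightarrow>
        distr M (count_space UNIV) (\<lambda>\<omega>. rings T t \<omega> - rings T s \<omega>)
          = measure_pmf (poisson_pmf (\<rho> * (t - s)))) \<and>
     (\<forall>t. incseq t \<and> 0 \<le> t 0 \<longrightarrow>
        prob_space.indep_vars M (\<lambda>_. count_space UNIV)
          (\<lambda>i \<omega>. rings T (t (Suc i)) \<omega> - rings T (t i) \<omega>) (UNIV :: nat set))"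

text \<open>The whole trajectory of a clock, as a random element of a product space.\<close>

abbreviation trajectory_space :: "(real \<Rightarrow> nat) measure" where
  "trajectory_space \<equiv> Pi\<^sub>M {0..} (\<lambda>_. count_space UNIV)"

definition trajectory :: "('w \<Rightarrow> real set) \<Rightarrow> 'w \<Rightarrow> real \<Rightarrow> nat" where
  "trajectory T \<omega> = (\<lambda>t\<in>{0..}. rings T t \<omega>)"

text \<open>
  A family of independent Poisson clocks of rate \<open>\<alpha>\<close>. Almost surely no two of them ring
  simultaneously; as usual, the exceptional null set is taken to be removed from the sample space,
  so that the order of the rings is always defined.
\<close>

definition poisson_clocks :: "'w measure \<Rightarrow> real \<Rightarrow> 'e set \<Rightarrow> ('e \<Rightarrow> 'w \<Rightarrow> real set) \<Rightarrow> bool" where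
  "poisson_clocks M \<alpha> E T \<longleftrightarrow>
     (\<forall>e\<in>E. poisson_clock M \<alpha> (T e)) \<and>
     prob_space.indep_vars M (\<lambda>_. trajectory_space) (\<lambda>e. trajectory (T e)) E \<and>
     (\<forall>\<omega>\<in>space M. disjoint_family_on (\<lambda>e. T e \<omega>) E)"

section \<open>The symmetric exclusion process\<close>

definition edge_swap :: "'a set \<Rightarrow> 'a \<Rightarrow> 'a" where
  "edge_swap e = (THE \<sigma>. \<exists>a b. e = {a, b} \<and> \<sigma> = Transposition.transpose a b)"

text \<open>
  The permutation \<open>\<pi>\<^sub>t\<close>: going through the ringing times up to \<open>t\<close> in increasing order, the
  transposition of the edge that rings is composed on the left.
\<close>

definition exclusion_perm :: "'a set set \<Rightarrow> ('a set \<Rightarrow> 'w \<Rightarrow> real set) \<Rightarrow> real \<Rightarrow> 'w \<Rightarrow> 'a \<Rightarrow> 'a" where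
  "exclusion_perm E T t \<omega> =
     fold (\<lambda>s \<pi>. edge_swap (THE e. e \<in> E \<and> s \<in> T e \<omega>) \<circ> \<pi>)
       (sorted_list_of_set (\<Union>e\<in>E. T e \<omega> \<inter> {..t})) id"

definition symmetric_exclusion_process ::
  "'w measure \<Rightarrow> 'a set \<Rightarrow> 'a set set \<Rightarrow> real \<Rightarrow> (real \<Rightarrow> 'w \<Rightarrow> 'a \<Rightarrow> bool) \<Rightarrow> bool" where
  "symmetric_exclusion_process M V E \<alpha> \<eta> \<longleftrightarrow> prob_space M \<and>
     (\<exists>T. poisson_clocks M \<alpha> E T \<and>
          \<eta> 0 \<in> measurable M (count_space (configs V)) \<and>
          distr M (count_space (configs V)) (\<eta> 0) = uniform_count_measure (configs V) \<and>
          prob_space.indep_set M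
            (sets (vimage_algebra (space M) (\<eta> 0) (count_space (configs V))))
            (sets (vimage_algebra (space M) (\<lambda>\<omega>. \<lambda>e\<in>E. trajectory (T e) \<omega>)
               (Pi\<^sub>M E (\<lambda>_. trajectory_space)))) \<and>
          (\<forall>t\<ge>0. \<forall>\<omega>\<in>space M. \<eta> t \<omega> = (\<lambda>x. \<eta> 0 \<omega> (inv (exclusion_perm E T t \<omega>) x))))"

text \<open>
  Exclusion sensitivity and stability, for realisations \<open>\<eta> n\<close> of the exclusion processes on
  probability spaces \<open>M n\<close>.
\<close>

definition XS :: "(nat \<Rightarrow> 'w measure) \<Rightarrow> (nat \<Rightarrow> real \<Rightarrow> 'w \<Rightarrow> 'a \<Rightarrow> bool) \<Rightarrow>
    (nat \<Rightarrow> ('a \<Rightarrow> bool) \<Rightarrow> real) \<Rightarrow> bool" where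
  "XS M \<eta> f \<longleftrightarrow> (\<exists>t>0.
     (\<lambda>n. prob_space.expectation (M n) (\<lambda>\<omega>. f n (\<eta> n 0 \<omega>) * f n (\<eta> n t \<omega>))
          - (prob_space.expectation (M n) (\<lambda>\<omega>. f n (\<eta> n 0 \<omega>)))\<^sup>2) \<longlonglongrightarrow> 0)"

definition XStable :: "(nat \<Rightarrow> 'w measure) \<Rightarrow> (nat \<Rightarrow> real \<Rightarrow> 'w \<Rightarrow> 'a \<Rightarrow> bool) \<Rightarrow>
    (nat \<Rightarrow> ('a \<Rightarrow> bool) \<Rightarrow> real) \<Rightarrow> bool" where
  "XStable M \<eta> f \<longleftrightarrow> (\<forall>\<delta>>0. \<exists>t>0. \<forall>n.
     measure (M n) {\<omega> \<in> space (M n). f n (\<eta> n 0 \<omega>) \<noteq> f n (\<eta> n t \<omega>)} \<le> \<delta>)"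

end

theory Submission
  imports Defs "HOL-Combinatorics.Permutations"
begin

text \<open>
  Write \<open>a(S)\<close> for the Fourier--Walsh coefficients of \<open>f\<close>. Resampling noise multiplies the
  coefficient of \<open>S\<close> by \<open>(1 - \<epsilon>) ^ card S\<close>. The exclusion process moves the coefficients along the
  walk \<open>S \<mapsto> e(S)\<close> on subsets, which preserves \<open>card S\<close> and is symmetric; at most \<open>d(G) card S\<close>
  edges move \<open>S\<close>, so its generator on sets of size \<open>k\<close> is bounded below by
  \<open>- 2 \<alpha> d(G) k \<ge> - 2 k\<close>. Hence
  \<open>E[f(\<eta>\<^sub>0) f(\<eta>\<^sub>t)] \<ge> \<Sum>\<^sub>S exp (- 2 t) ^ card S * a(S)\<^sup>2\<close>,
  that is, the exclusion process at time \<open>t\<close> decorrelates no more than the noise with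
  \<open>1 - \<epsilon> = exp (- 2 t)\<close>. Both parts follow. The inequality is proved without generators: cut
  \<open>[0, t]\<close> into \<open>N\<close> equal pieces and keep a ring only if it is the sole one in its piece. For each
  outcome the resulting permutation is \<open>\<pi>\<^sub>t\<close> once \<open>N\<close> is large, while for fixed \<open>N\<close> it is a product
  of independent identically distributed lazy transpositions.
\<close>

section \<open>Fourier--Walsh expansion and noise\<close>

definition walsh :: "'a set \<Rightarrow> ('a \<Rightarrow> bool) \<Rightarrow> real" where
  "walsh S \<omega> = (\<Prod>x\<in>S. if \<omega> x then 1 else -1)"

definition fourier :: "'a set \<Rightarrow> (('a \<Rightarrow> bool) \<Rightarrow> real) \<Rightarrow> 'a set \<Rightarrow> real" where
  "fourier V f S = measure_pmf.expectation (pmf_of_set (configs V)) (\<lambda>\<omega>. f \<omega> * walsh S \<omega>)"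

lemma finite_configs: "finite V \<Longrightarrow> finite (configs V)"
  by (auto simp: configs_def intro!: finite_PiE)

lemma configs_nonempty: "configs V \<noteq> {}"
  by (simp add: configs_def PiE_eq_empty_iff)

lemma card_configs: "finite V \<Longrightarrow> card (configs V) = 2 ^ card V"
  by (simp add: configs_def card_PiE)

lemma expectation_configs:
  "finite V \<Longrightarrow> measure_pmf.expectation (pmf_of_set (configs V)) g
     = (\<Sum>\<omega>\<in>configs V. g \<omega>) / 2 ^ card V" for g :: "_ \<Rightarrow> real"
  by (subst integral_pmf_of_set) (simp_all add: finite_configs configs_nonempty card_configs)

lemma fourier_empty:
  "fourier V f {} = measure_pmf.expectation (pmf_of_set (configs V)) f"
  by (simp add: fourier_def walsh_def)

lemma sum_configs_prod:
  fixes g :: "'a \<Rightarrow> bool \<Rightarrow> real"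
  assumes "finite V"
  shows "(\<Sum>\<omega>\<in>configs V. \<Prod>x\<in>V. g x (\<omega> x)) = (\<Prod>x\<in>V. g x True + g x False)"
  using prod_sum_PiE[of V "\<lambda>_. UNIV" g] assms by (simp add: configs_def UNIV_bool add.commute)

text \<open>Orthogonality on the dual side: the sum runs over subsets, not configurations, and so is
  the completeness relation behind inversion. Expanding over subsets gives a product of factors
  \<open>1 + s x\<close>, and one coordinate where the configurations differ makes its factor
  vanish.\<close>

lemma sum_walsh_mult:
  assumes V: "finite V" and "\<omega> \<in> configs V" "\<omega>' \<in> configs V"
  shows "(\<Sum>S\<in>Pow V. walsh S \<omega>' * walsh S \<omega>) = (if \<omega>' = \<omega> then 2 ^ card V else 0)"
proof -
  let ?s = "\<lambda>x. (if \<omega>' x then 1 else -1) * (if \<omega> x then 1 else -1) :: real"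
  have "(\<Sum>S\<in>Pow V. walsh S \<omega>' * walsh S \<omega>) = (\<Sum>S\<in>Pow V. (\<Prod>x\<in>S. ?s x) * (\<Prod>x\<in>V-S. 1))"
    by (simp add: walsh_def prod.distrib)
  also have "\<dots> = (\<Prod>x\<in>V. ?s x + 1)"
    by (rule prod_add[OF V, symmetric])
  also have "\<dots> = (if \<omega>' = \<omega> then 2 ^ card V else 0)"
  proof (cases "\<omega>' = \<omega>")
    case True
    then have "(\<Prod>x\<in>V. ?s x + 1) = (\<Prod>x\<in>V. 2)" by (intro prod.cong) auto
    with True show ?thesis by simp
  next
    case False
    then obtain x where "\<omega>' x \<noteq> \<omega> x" by auto
    \<comment> \<open>Configurations are extensional: outside \<open>V\<close> both equal
      \<open>undefined\<close>, so they can differ only inside.\<close>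
    moreover from this have "x \<in> V"
      using assms(2,3) unfolding configs_def by (metis PiE_arb)
    ultimately have "(\<Prod>x\<in>V. ?s x + 1) = 0"
      using V by (intro prod_zero) (auto intro!: bexI[of _ x])
    with False show ?thesis by simp
  qed
  finally show ?thesis .
qed

lemma fourier_inversion:
  assumes V: "finite V" and \<omega>: "\<omega> \<in> configs V"
  shows "f \<omega> = (\<Sum>S\<in>Pow V. fourier V f S * walsh S \<omega>)"
proof -
  have "(\<Sum>S\<in>Pow V. fourier V f S * walsh S \<omega>)
      = (\<Sum>S\<in>Pow V. \<Sum>\<omega>'\<in>configs V. f \<omega>' * (walsh S \<omega>' * walsh S \<omega>) / 2 ^ card V)"
    by (simp add: fourier_def expectation_configs[OF V] sum_divide_distrib sum_distrib_right mult.assoc)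
  also have "\<dots> = (\<Sum>\<omega>'\<in>configs V. f \<omega>' * (\<Sum>S\<in>Pow V. walsh S \<omega>' * walsh S \<omega>) / 2 ^ card V)"
    by (subst sum.swap) (simp add: sum_distrib_left sum_divide_distrib)
  also have "\<dots> = (\<Sum>\<omega>'\<in>configs V. if \<omega>' = \<omega> then f \<omega>' else 0)"
    by (intro sum.cong) (simp_all add: sum_walsh_mult[OF V \<omega>])
  also have "\<dots> = f \<omega>"
    using \<omega> finite_configs[OF V] by simp
  finally show ?thesis by simp
qed

text \<open>
  A kernel that multiplies or permutes the characters is diagonalised by expanding only the second
  factor; the first factor turns each character into a Fourier coefficient.
\<close>

lemma expectation_mult_eq_sum_fourier:
  assumes V: "finite V"
    and g: "\<And>\<omega>. \<omega> \<in> configs V \<Longrightarrow> g \<omega> = (\<Sum>S\<in>Pow V. b S * walsh (\<tau> S) \<omega>)"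
  shows "measure_pmf.expectation (pmf_of_set (configs V)) (\<lambda>\<omega>. f \<omega> * g \<omega>)
           = (\<Sum>S\<in>Pow V. b S * fourier V f (\<tau> S))"
proof -
  have "(\<Sum>\<omega>\<in>configs V. f \<omega> * g \<omega>) = (\<Sum>\<omega>\<in>configs V. \<Sum>S\<in>Pow V. b S * (f \<omega> * walsh (\<tau> S) \<omega>))"
    by (intro sum.cong) (simp_all add: g sum_distrib_left mult.left_commute)
  also have "\<dots> = (\<Sum>S\<in>Pow V. b S * (\<Sum>\<omega>\<in>configs V. f \<omega> * walsh (\<tau> S) \<omega>))"
    by (subst sum.swap) (simp add: sum_distrib_left)
  finally show ?thesis
    by (simp only: fourier_def expectation_configs[OF V] times_divide_eq_right
        sum_divide_distrib[symmetric])
qed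

lemma parseval:
  assumes V: "finite V"
  shows "measure_pmf.expectation (pmf_of_set (configs V)) (\<lambda>\<omega>. f \<omega> * f \<omega>)
           = (\<Sum>S\<in>Pow V. (fourier V f S)\<^sup>2)"
  using expectation_mult_eq_sum_fourier[where \<tau>="\<lambda>S. S", OF V fourier_inversion[OF V], of f f]
  by (simp add: power2_eq_square)

section \<open>The noise operator on characters\<close>

lemma expectation_bind_finite:
  fixes h :: "'b \<Rightarrow> real"
  assumes "finite (set_pmf p)" "\<And>x. x \<in> set_pmf p \<Longrightarrow> finite (set_pmf (k x))"
  shows "measure_pmf.expectation (p \<bind> k) h
           = measure_pmf.expectation p (\<lambda>x. measure_pmf.expectation (k x) h)"
  using assms by (subst pmf_expectation_bind[of "set_pmf p"])
    (auto simp: integral_measure_pmf[of "set_pmf p"])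

lemma finite_set_Pi_pmf:
  assumes "finite A" "\<And>x. x \<in> A \<Longrightarrow> finite (set_pmf (p x))"
  shows "finite (set_pmf (Pi_pmf A d p))"
  using assms by (auto simp: set_Pi_pmf intro!: finite_PiE_dflt)

lemma expectation_noisy_pair:
  fixes h :: "_ \<Rightarrow> real"
  assumes V: "finite V"
  shows "measure_pmf.expectation (noisy_pair V \<epsilon>) h =
    measure_pmf.expectation (pmf_of_set (configs V)) (\<lambda>\<omega>.
      measure_pmf.expectation (Pi_pmf V False (\<lambda>_. bernoulli_pmf \<epsilon>)) (\<lambda>r.
        measure_pmf.expectation (pmf_of_set (configs V)) (\<lambda>\<xi>.
          h (\<omega>, \<lambda>x\<in>V. if r x then \<xi> x else \<omega> x))))"
  using V unfolding noisy_pair_def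
  by (subst expectation_bind_finite |
      auto simp: finite_configs configs_nonempty finite_set_Pi_pmf)+

text \<open>A fresh fair bit at a point of \<open>S\<close> averages its sign to zero. The character
  therefore survives exactly when no point of \<open>S\<close> is resampled, which has probability
  \<open>(1 - \<epsilon>) ^ card S\<close>.\<close>

lemma noise_walsh:
  assumes V: "finite V" and S: "S \<subseteq> V" and \<epsilon>: "0 \<le> \<epsilon>" "\<epsilon> \<le> 1"
  shows "measure_pmf.expectation (Pi_pmf V False (\<lambda>_. bernoulli_pmf \<epsilon>)) (\<lambda>r.
        measure_pmf.expectation (pmf_of_set (configs V)) (\<lambda>\<xi>.
          walsh S (\<lambda>x\<in>V. if r x then \<xi> x else \<omega> x)))
       = (1 - \<epsilon>) ^ card S * walsh S \<omega>"
proof -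
  let ?s = "\<lambda>b. if b then 1 else -1 :: real"
  let ?g = "\<lambda>r x. if x \<in> S then (if r then 0 else ?s (\<omega> x)) else 1"
  let ?k = "\<lambda>x r. if x \<in> S \<and> r then 0 else 1 :: real"
  \<comment> \<open>Products over \<open>S\<close> are padded with factors 1 to products over
    \<open>V\<close>, the form in which both product measures factorise.\<close>
  have restrict: "(\<Prod>x\<in>S. k x) = (\<Prod>x\<in>V. if x \<in> S then k x else 1)" for k :: "'a \<Rightarrow> real"
    using V S by (simp add: prod.If_cases inf.absorb2)
  have "measure_pmf.expectation (pmf_of_set (configs V)) (\<lambda>\<xi>.
          walsh S (\<lambda>x\<in>V. if r x then \<xi> x else \<omega> x)) = (\<Prod>x\<in>V. ?g (r x) x)" for r
  proof -
    have "walsh S (\<lambda>x\<in>V. if r x then \<xi> x else \<omega> x)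
       = (\<Prod>x\<in>V. if x \<in> S then (if r x then ?s (\<xi> x) else ?s (\<omega> x)) else 1)" for \<xi>
      unfolding walsh_def restrict by (intro prod.cong) auto
    then have "(\<Sum>\<xi>\<in>configs V. walsh S (\<lambda>x\<in>V. if r x then \<xi> x else \<omega> x))
      = (\<Prod>x\<in>V. (if x \<in> S then (if r x then ?s True else ?s (\<omega> x)) else 1)
            + (if x \<in> S then (if r x then ?s False else ?s (\<omega> x)) else 1))"
      using sum_configs_prod[OF V,
        of "\<lambda>x b. if x \<in> S then (if r x then ?s b else ?s (\<omega> x)) else 1"] by simp
    \<comment> \<open>Each coordinate yields a factor 2: a resampled point of \<open>S\<close> gives
      1 - 1 = 0, every other point counts its value twice. These factors cancel the normalisation by
      \<open>2 ^ card V\<close>.\<close>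
    also have "\<dots> = (\<Prod>x\<in>V. 2 * ?g (r x) x)"
      by (intro prod.cong) auto
    finally show ?thesis
      by (simp only: expectation_configs[OF V] prod.distrib prod_constant) simp
  qed
  moreover have "(\<Prod>x\<in>V. ?g (r x) x) = walsh S \<omega> * (\<Prod>x\<in>V. ?k x (r x))" for r
    unfolding walsh_def restrict prod.distrib[symmetric] by (intro prod.cong) auto
  moreover have "measure_pmf.expectation (Pi_pmf V False (\<lambda>_. bernoulli_pmf \<epsilon>)) (\<lambda>r. \<Prod>x\<in>V. ?k x (r x))
      = (\<Prod>x\<in>V. measure_pmf.expectation (bernoulli_pmf \<epsilon>) (?k x))"
    by (rule expectation_prod_Pi_pmf[OF V]) (simp_all add: integrable_measure_pmf_finite)
  moreover have "\<dots> = (\<Prod>x\<in>S. 1 - \<epsilon>)"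
    unfolding restrict using \<epsilon> by (intro prod.cong) auto
  ultimately show ?thesis
    by simp
qed

lemma noisy_pair_fourier:
  assumes V: "finite V" and \<epsilon>: "0 \<le> \<epsilon>" "\<epsilon> \<le> 1"
  shows "measure_pmf.expectation (noisy_pair V \<epsilon>) (\<lambda>(\<omega>, \<omega>'). f \<omega> * f \<omega>')
       = (\<Sum>S\<in>Pow V. (1 - \<epsilon>) ^ card S * (fourier V f S)\<^sup>2)"
proof -
  let ?B = "Pi_pmf V False (\<lambda>_. bernoulli_pmf \<epsilon>)"
  let ?w = "\<lambda>\<omega> r \<xi>. \<lambda>x\<in>V. if r x then \<xi> x else \<omega> x"
  have w: "?w \<omega> r \<xi> \<in> configs V" for \<omega> r \<xi>
    by (auto simp: configs_def)
  have fin: "finite (set_pmf ?B)" "finite (set_pmf (pmf_of_set (configs V)))"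
    using V by (auto simp: finite_set_Pi_pmf finite_configs configs_nonempty)
  have "measure_pmf.expectation ?B (\<lambda>r. measure_pmf.expectation (pmf_of_set (configs V)) (\<lambda>\<xi>. f (?w \<omega> r \<xi>)))
      = (\<Sum>S\<in>Pow V. (fourier V f S * (1 - \<epsilon>) ^ card S) * walsh S \<omega>)" for \<omega>
    using V \<epsilon> by (simp add: fourier_inversion[OF V w, where f=f] Bochner_Integration.integral_sum
        integrable_measure_pmf_finite fin noise_walsh mult.assoc)
  then have "measure_pmf.expectation (noisy_pair V \<epsilon>) (\<lambda>(\<omega>, \<omega>'). f \<omega> * f \<omega>')
      = measure_pmf.expectation (pmf_of_set (configs V))
          (\<lambda>\<omega>. f \<omega> * (\<Sum>S\<in>Pow V. (fourier V f S * (1 - \<epsilon>) ^ card S) * walsh S \<omega>))"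
    by (simp add: expectation_noisy_pair[OF V])
  also have "\<dots> = (\<Sum>S\<in>Pow V. (fourier V f S * (1 - \<epsilon>) ^ card S) * fourier V f S)"
    by (rule expectation_mult_eq_sum_fourier[where \<tau>="\<lambda>S. S", OF V]) simp
  finally show ?thesis
    by (simp add: power2_eq_square mult_ac)
qed

section \<open>Lazy random transpositions\<close>

text \<open>The averaging operator of a lazy walk: the move \<open>s e\<close> is made with
  probability \<open>p\<close> for each \<open>e\<close>, and the walk stays put with the remaining
  probability. The state space is left abstract so that it can later be a layer of sets of one
  size.\<close>

definition swap_step :: "'e set \<Rightarrow> ('e \<Rightarrow> 'x \<Rightarrow> 'x) \<Rightarrow> real \<Rightarrow> ('x \<Rightarrow> real) \<Rightarrow> 'x \<Rightarrow> real" where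
  "swap_step E s p h x = h x + p * (\<Sum>e\<in>E. h (s e x) - h x)"

lemma sum_involution:
  fixes g :: "'x \<Rightarrow> real"
  assumes "\<And>x. x \<in> X \<Longrightarrow> \<sigma> x \<in> X" "\<And>x. x \<in> X \<Longrightarrow> \<sigma> (\<sigma> x) = x"
  shows "(\<Sum>x\<in>X. g (\<sigma> x)) = (\<Sum>x\<in>X. g x)"
  using assms by (intro sum.reindex_bij_witness[of _ \<sigma> \<sigma>]) auto

text \<open>Each move is an involution of \<open>X\<close>, so substituting \<open>s e x\<close> for
  \<open>x\<close> carries it from one factor to the other.\<close>

lemma swap_step_symmetric:
  assumes X: "finite X" and s: "\<And>e x. e \<in> E \<Longrightarrow> x \<in> X \<Longrightarrow> s e x \<in> X"
    and inv: "\<And>e x. e \<in> E \<Longrightarrow> x \<in> X \<Longrightarrow> s e (s e x) = x"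
  shows "(\<Sum>x\<in>X. g x * swap_step E s p h x) = (\<Sum>x\<in>X. swap_step E s p g x * h x)"
proof -
  have "(\<Sum>x\<in>X. g x * h (s e x)) = (\<Sum>x\<in>X. g (s e x) * h x)" if "e \<in> E" for e
    using sum_involution[of X "s e" "\<lambda>x. g x * h (s e x)"] s inv that by simp
  then have "(\<Sum>x\<in>X. g x * (h (s e x) - h x)) = (\<Sum>x\<in>X. (g (s e x) - g x) * h x)" if "e \<in> E" for e
    using that by (simp add: left_diff_distrib right_diff_distrib sum_subtractf)
  then have "(\<Sum>e\<in>E. \<Sum>x\<in>X. g x * (h (s e x) - h x)) = (\<Sum>e\<in>E. \<Sum>x\<in>X. (g (s e x) - g x) * h x)"
    by (rule sum.cong[OF refl])
  then have "(\<Sum>x\<in>X. g x * (\<Sum>e\<in>E. h (s e x) - h x)) = (\<Sum>x\<in>X. (\<Sum>e\<in>E. g (s e x) - g x) * h x)"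
    by (simp add: sum_distrib_left sum_distrib_right sum.swap[of _ E X])
  then have "p * (\<Sum>x\<in>X. g x * (\<Sum>e\<in>E. h (s e x) - h x)) = p * (\<Sum>x\<in>X. (\<Sum>e\<in>E. g (s e x) - g x) * h x)"
    by simp
  then show ?thesis
    by (simp add: swap_step_def algebra_simps sum.distrib sum_distrib_left)
qed

text \<open>A bound on the Dirichlet form, edge by edge: an edge costs at most twice the mass of
  \<open>h\<close> squared on the points it moves. Summing over edges counts each point at most
  \<open>D\<close> times.\<close>

lemma swap_step_quadratic_form:
  assumes X: "finite X" and E: "finite E"
    and s: "\<And>e x. e \<in> E \<Longrightarrow> x \<in> X \<Longrightarrow> s e x \<in> X"
    and inv: "\<And>e x. e \<in> E \<Longrightarrow> x \<in> X \<Longrightarrow> s e (s e x) = x"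
    and D: "\<And>x. x \<in> X \<Longrightarrow> real (card {e \<in> E. s e x \<noteq> x}) \<le> D" and p: "0 \<le> p"
  shows "(1 - 2 * p * D) * (\<Sum>x\<in>X. (h x)\<^sup>2) \<le> (\<Sum>x\<in>X. h x * swap_step E s p h x)"
proof -
  have edge: "- 2 * (\<Sum>x\<in>X. if s e x \<noteq> x then (h x)\<^sup>2 else 0) \<le> (\<Sum>x\<in>X. h x * (h (s e x) - h x))"
    if e: "e \<in> E" for e
  proof -
    let ?m = "\<lambda>x. if s e x \<noteq> x then (h x)\<^sup>2 else 0"
    have "(\<Sum>x\<in>X. ?m (s e x)) = (\<Sum>x\<in>X. ?m x)"
      by (rule sum_involution) (use s inv e in auto)
    \<comment> \<open>With y = \<open>s e x\<close>, the inequality (h x + h y)^2 >= 0 gives h x (h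
      y - h x) >= -(3/2) (h x)^2 - (1/2) (h y)^2. The factor 2 is split accordingly, since both
      halves have the same total mass.\<close>
    then have "- 2 * (\<Sum>x\<in>X. ?m x) = (\<Sum>x\<in>X. - (3/2) * ?m x - (1/2) * ?m (s e x))"
      unfolding sum_subtractf sum_distrib_left[symmetric] by simp
    also have "\<dots> \<le> (\<Sum>x\<in>X. h x * (h (s e x) - h x))"
    proof (intro sum_mono)
      fix x assume x: "x \<in> X"
      show "- (3/2) * ?m x - (1/2) * ?m (s e x) \<le> h x * (h (s e x) - h x)"
      proof (cases "s e x = x")
        case False
        \<comment> \<open>The partner point is moved too, so \<open>?m (s e x)\<close> is the square
          of \<open>h (s e x)\<close> and not 0.\<close>
        with inv[OF e x] have "s e (s e x) \<noteq> s e x" by metis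
        moreover have "0 \<le> (h x + h (s e x))\<^sup>2" by simp
        ultimately show ?thesis using False
          by (simp add: power2_sum power2_eq_square algebra_simps)
      qed simp
    qed
    finally show ?thesis .
  qed
  have "(\<Sum>e\<in>E. \<Sum>x\<in>X. if s e x \<noteq> x then (h x)\<^sup>2 else 0)
      = (\<Sum>x\<in>X. real (card {e \<in> E. s e x \<noteq> x}) * (h x)\<^sup>2)"
    using E by (subst sum.swap) (simp add: sum.If_cases Int_def)
  also have "\<dots> \<le> (\<Sum>x\<in>X. D * (h x)\<^sup>2)"
    by (intro sum_mono mult_right_mono D) auto
  finally have "- 2 * (D * (\<Sum>x\<in>X. (h x)\<^sup>2)) \<le> (\<Sum>e\<in>E. - 2 * (\<Sum>x\<in>X. if s e x \<noteq> x then (h x)\<^sup>2 else 0))"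
    unfolding sum_distrib_left[symmetric] by simp
  also have "\<dots> \<le> (\<Sum>e\<in>E. \<Sum>x\<in>X. h x * (h (s e x) - h x))"
    by (intro sum_mono edge)
  also have "\<dots> = (\<Sum>x\<in>X. h x * (\<Sum>e\<in>E. h (s e x) - h x))"
    by (subst sum.swap) (simp add: sum_distrib_left)
  finally have "p * (- 2 * (D * (\<Sum>x\<in>X. (h x)\<^sup>2))) \<le> p * (\<Sum>x\<in>X. h x * (\<Sum>e\<in>E. h (s e x) - h x))"
    by (rule mult_left_mono[OF _ p])
  moreover have "(\<Sum>x\<in>X. h x * swap_step E s p h x)
      = (\<Sum>x\<in>X. (h x)\<^sup>2) + p * (\<Sum>x\<in>X. h x * (\<Sum>e\<in>E. h (s e x) - h x))"
    by (simp add: swap_step_def algebra_simps power2_eq_square sum.distrib sum_distrib_left)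
  ultimately show ?thesis
    by (simp add: algebra_simps)
qed

text \<open>
  Symmetry moves half of the steps to the other factor, so no spectral theorem is needed:
  the exponent is lowered by two at a time.
\<close>

lemma swap_step_power_quadratic_form:
  assumes X: "finite X" and E: "finite E"
    and s: "\<And>e x. e \<in> E \<Longrightarrow> x \<in> X \<Longrightarrow> s e x \<in> X"
    and inv: "\<And>e x. e \<in> E \<Longrightarrow> x \<in> X \<Longrightarrow> s e (s e x) = x"
    and D: "\<And>x. x \<in> X \<Longrightarrow> real (card {e \<in> E. s e x \<noteq> x}) \<le> D"
    and p: "0 \<le> p" "2 * p * D \<le> 1"
  shows "(1 - 2 * p * D) ^ N * (\<Sum>x\<in>X. (h x)\<^sup>2) \<le> (\<Sum>x\<in>X. h x * (swap_step E s p ^^ N) h x)"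
proof (induction N arbitrary: h rule: induct_nat_012)
  case 0
  then show ?case by (simp add: power2_eq_square)
next
  case 1
  show ?case using swap_step_quadratic_form[OF X E s inv D p(1)] by simp
next
  case (ge2 N)
  let ?K = "swap_step E s p" and ?c = "1 - 2 * p * D"
  \<comment> \<open>Expanding this square gives |K h|^2 >= 2 c <h, K h> - c^2 |h|^2. With <h, K h>
    >= c |h|^2 and c >= 0 this yields |K h|^2 >= c^2 |h|^2, which pays for two steps at
    once.\<close>
  have "0 \<le> (\<Sum>x\<in>X. (?K h x - ?c * h x)\<^sup>2)"
    by (simp add: sum_nonneg)
  also have "\<dots> = (\<Sum>x\<in>X. (?K h x)\<^sup>2) - 2 * ?c * (\<Sum>x\<in>X. h x * ?K h x) + ?c\<^sup>2 * (\<Sum>x\<in>X. (h x)\<^sup>2)"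
    unfolding sum_distrib_left sum_subtractf[symmetric] sum.distrib[symmetric]
    by (intro sum.cong) (simp_all add: power2_eq_square algebra_simps)
  finally have "0 \<le> (\<Sum>x\<in>X. (?K h x)\<^sup>2) - 2 * ?c * (\<Sum>x\<in>X. h x * ?K h x) + ?c\<^sup>2 * (\<Sum>x\<in>X. (h x)\<^sup>2)" .
  moreover have "?c * (?c * (\<Sum>x\<in>X. (h x)\<^sup>2)) \<le> ?c * (\<Sum>x\<in>X. h x * ?K h x)"
    using swap_step_quadratic_form[OF X E s inv D p(1)] p by (intro mult_left_mono) auto
  ultimately have sq: "?c\<^sup>2 * (\<Sum>x\<in>X. (h x)\<^sup>2) \<le> (\<Sum>x\<in>X. (?K h x)\<^sup>2)"
    by (simp add: power2_eq_square algebra_simps)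
  have "?c ^ Suc (Suc N) * (\<Sum>x\<in>X. (h x)\<^sup>2) = ?c ^ N * (?c\<^sup>2 * (\<Sum>x\<in>X. (h x)\<^sup>2))"
    by (simp add: power2_eq_square mult_ac)
  also have "\<dots> \<le> ?c ^ N * (\<Sum>x\<in>X. (?K h x)\<^sup>2)"
    using sq p by (intro mult_left_mono) auto
  also have "\<dots> \<le> (\<Sum>x\<in>X. ?K h x * (?K ^^ N) (?K h) x)"
    by (rule ge2.IH(1))
  also have "\<dots> = (\<Sum>x\<in>X. h x * ?K ((?K ^^ N) (?K h)) x)"
    by (rule swap_step_symmetric[OF X s inv, symmetric])
  also have "\<dots> = (\<Sum>x\<in>X. h x * (?K ^^ Suc (Suc N)) h x)"
    by (simp only: funpow.simps(2)[of "Suc N"] funpow_Suc_right[of N] comp_apply)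
  finally show ?case .
qed

section \<open>Edge transpositions acting on vertex sets\<close>

lemma edge_swap_doubleton: "edge_swap {a, b} = Transposition.transpose a b"
  unfolding edge_swap_def
proof (rule the_equality)
  fix \<sigma> assume "\<exists>a' b'. {a, b} = {a', b'} \<and> \<sigma> = Transposition.transpose a' b'"
  then show "\<sigma> = Transposition.transpose a b"
    by (auto simp: doubleton_eq_iff transpose_commute)
qed auto

lemma finite_graph_edgeE:
  assumes "finite_graph V E" "e \<in> E"
  obtains a b where "a \<in> V" "b \<in> V" "a \<noteq> b" "e = {a, b}"
  using assms unfolding finite_graph_def by blast

lemma finite_graph_edges: "finite_graph V E \<Longrightarrow> finite E"
  by (rule finite_subset[of _ "Pow V"]) (auto simp: finite_graph_def)

lemma edge_swap_permutes:
  assumes "finite_graph V E" "e \<in> E"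
  shows "edge_swap e permutes V"
  using assms by (elim finite_graph_edgeE) (auto simp: edge_swap_doubleton permutes_swap_id)

lemma edge_swap_involutive:
  assumes "finite_graph V E" "e \<in> E"
  shows "edge_swap e (edge_swap e x) = x"
  using assms by (elim finite_graph_edgeE) (auto simp: edge_swap_doubleton)

text \<open>An edge with both endpoints outside \<open>S\<close> fixes \<open>S\<close> pointwise,
  so every edge that moves \<open>S\<close> is incident to one of its vertices; a union bound over
  these vertices finishes.\<close>

lemma card_edge_swap_moves:
  assumes G: "finite_graph V E" and S: "S \<subseteq> V"
  shows "card {e \<in> E. edge_swap e ` S \<noteq> S} \<le> max_degree V E * card S"
proof -
  have fin: "finite V" "finite E" "finite S"
    using G S finite_graph_edges finite_subset by (auto simp: finite_graph_def)
  have "{e \<in> E. edge_swap e ` S \<noteq> S} \<subseteq> (\<Union>v\<in>S. {e \<in> E. v \<in> e})"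
  proof
    fix e assume "e \<in> {e \<in> E. edge_swap e ` S \<noteq> S}"
    then have e: "e \<in> E" "edge_swap e ` S \<noteq> S" by auto
    obtain a b where ab: "e = {a, b}" using finite_graph_edgeE[OF G e(1)] .
    have "edge_swap e ` S = S" if "a \<notin> S" "b \<notin> S"
      using that by (simp add: ab edge_swap_doubleton transpose_image_eq)
    with e ab show "e \<in> (\<Union>v\<in>S. {e \<in> E. v \<in> e})" by auto
  qed
  then have "card {e \<in> E. edge_swap e ` S \<noteq> S} \<le> card (\<Union>v\<in>S. {e \<in> E. v \<in> e})"
    using fin by (intro card_mono) auto
  also have "\<dots> \<le> (\<Sum>v\<in>S. card {e \<in> E. v \<in> e})"
    by (rule card_UN_le[OF fin(3)])
  also have "\<dots> \<le> (\<Sum>v\<in>S. max_degree V E)"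
    using fin S by (intro sum_mono) (auto simp: max_degree_def intro!: Max_ge)
  finally show ?thesis by (simp add: mult.commute)
qed

text \<open>Transpositions preserve cardinality, so \<open>Pow V\<close> splits into invariant
  layers of sets of size \<open>k\<close>, each with its own constant
  \<open>D = max_degree V E * k\<close>. The smallness condition on \<open>p\<close> is tightest for
  the top layer \<open>k = card V\<close>.\<close>

lemma exclusion_step_quadratic_form:
  fixes a :: "'a set \<Rightarrow> real" and p :: real
  assumes G: "finite_graph V E" and p: "0 \<le> p" "2 * p * (max_degree V E * card V) \<le> 1"
  shows "(\<Sum>S\<in>Pow V. (1 - 2 * p * (max_degree V E * card S)) ^ N * (a S)\<^sup>2)
       \<le> (\<Sum>S\<in>Pow V. a S * (swap_step E (\<lambda>e. (`) (edge_swap e)) p ^^ N) a S)"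
proof -
  let ?d = "max_degree V E" and ?K = "swap_step E (\<lambda>e. (`) (edge_swap e)) p"
  have V: "finite V" using G by (simp add: finite_graph_def)
  have level: "(1 - 2 * p * (?d * k)) ^ N * (\<Sum>S\<in>{S \<in> Pow V. card S = k}. (a S)\<^sup>2)
      \<le> (\<Sum>S\<in>{S \<in> Pow V. card S = k}. a S * (?K ^^ N) a S)" if k: "k \<le> card V" for k
  proof (rule swap_step_power_quadratic_form)
    fix e S assume e: "e \<in> E" and S: "S \<in> {S \<in> Pow V. card S = k}"
    have "edge_swap e permutes V" by (rule edge_swap_permutes[OF G e])
    with S show "edge_swap e ` S \<in> {S \<in> Pow V. card S = k}"
      by (auto simp: card_image permutes_inj_on permutes_in_image)
    show "edge_swap e ` edge_swap e ` S = S"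
      by (simp add: image_image edge_swap_involutive[OF G e])
  next
    fix S assume S: "S \<in> {S \<in> Pow V. card S = k}"
    then have "card {e \<in> E. edge_swap e ` S \<noteq> S} \<le> ?d * k"
      using card_edge_swap_moves[OF G, of S] by auto
    then show "real (card {e \<in> E. edge_swap e ` S \<noteq> S}) \<le> real (?d * k)"
      by (simp only: of_nat_le_iff)
  next
    have "p * real (?d * k) \<le> p * real (?d * card V)"
      using k p(1) by (intro mult_left_mono) (auto simp flip: of_nat_mult)
    then show "2 * p * real (?d * k) \<le> 1" using p(2) by simp
  qed (use V p finite_graph_edges[OF G] in auto)
  have levels: "(\<Sum>S\<in>Pow V. g S) = (\<Sum>k\<le>card V. \<Sum>S\<in>{S \<in> Pow V. card S = k}. g S)" for g :: "_ \<Rightarrow> real"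
    using V by (intro sum.group[symmetric]) (auto intro: card_mono)
  have "(\<Sum>S\<in>Pow V. (1 - 2 * p * (?d * card S)) ^ N * (a S)\<^sup>2)
      = (\<Sum>k\<le>card V. (1 - 2 * p * (?d * k)) ^ N * (\<Sum>S\<in>{S \<in> Pow V. card S = k}. (a S)\<^sup>2))"
    unfolding levels by (intro sum.cong) (auto simp: sum_distrib_left)
  also have "\<dots> \<le> (\<Sum>S\<in>Pow V. a S * (?K ^^ N) a S)"
    unfolding levels by (intro sum_mono level) auto
  finally show ?thesis .
qed

section \<open>Discretised clocks\<close>

text \<open>Cells with two or more rings are treated as empty. The outcome then depends on the
  counts alone, never on the order of rings within a cell.\<close>

definition sole_ring :: "'e set \<Rightarrow> ('e \<Rightarrow> nat) \<Rightarrow> 'e option" where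
  "sole_ring E c = (if \<exists>e\<in>E. \<forall>e'\<in>E. c e' = (if e' = e then 1 else 0)
     then Some (SOME e. e \<in> E \<and> (\<forall>e'\<in>E. c e' = (if e' = e then 1 else 0))) else None)"

lemma sole_ring_eq_Some_iff:
  "sole_ring E c = Some e \<longleftrightarrow> e \<in> E \<and> (\<forall>e'\<in>E. c e' = (if e' = e then 1 else 0))"
proof -
  define P where "P e \<longleftrightarrow> e \<in> E \<and> (\<forall>e'\<in>E. c e' = (if e' = e then 1 else 0))" for e
  have eq: "sole_ring E c = (if \<exists>e. P e then Some (SOME e. P e) else None)"
    unfolding sole_ring_def P_def Bex_def ..
  have "x = y" if "P x" "P y" for x y
  proof (rule ccontr)
    assume "x \<noteq> y"
    with \<open>P x\<close> \<open>P y\<close> show False unfolding P_def by auto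
  qed
  then have "sole_ring E c = Some e \<longleftrightarrow> P e"
    unfolding eq using someI[of P] by auto
  then show ?thesis unfolding P_def .
qed

lemma sole_ring_cong: "(\<And>e. e \<in> E \<Longrightarrow> c e = c' e) \<Longrightarrow> sole_ring E c = sole_ring E c'"
  by (simp add: sole_ring_def cong: conj_cong)

lemma sole_ring_range: "sole_ring E c \<in> insert None (Some ` E)"
  using sole_ring_eq_Some_iff[of E c] by (cases "sole_ring E c") auto

fun walk :: "(nat \<Rightarrow> 'a set option) \<Rightarrow> nat \<Rightarrow> 'a \<Rightarrow> 'a" where
  "walk z 0 = id"
| "walk z (Suc i) = (case z i of None \<Rightarrow> id | Some e \<Rightarrow> edge_swap e) \<circ> walk z i"

lemma walk_cong: "(\<And>i. i < n \<Longrightarrow> z i = z' i) \<Longrightarrow> walk z n = walk z' n"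
  by (induction n) auto

lemma walk_permutes:
  assumes G: "finite_graph V E" and z: "\<And>i. i < n \<Longrightarrow> z i \<in> insert None (Some ` E)"
  shows "walk z n permutes V"
  using z
proof (induction n)
  case 0
  then show ?case by (simp only: walk.simps permutes_id)
next
  case (Suc n)
  have "(case z n of None \<Rightarrow> id | Some e \<Rightarrow> edge_swap e) permutes V"
    using Suc.prems[of n] edge_swap_permutes[OF G] by (cases "z n") (auto simp: permutes_id)
  moreover have "walk z n permutes V"
    using Suc.prems by (intro Suc.IH) simp
  ultimately show ?case
    by (simp only: walk.simps permutes_compose)
qed

text \<open>Rings in the cell from \<open>\<delta> * i\<close> (excluded) to
  \<open>\<delta> * (i + 1)\<close> (included); the difference of naturals does not truncate because
  \<open>rings\<close> counts cumulatively.\<close>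

definition ring_count :: "('e \<Rightarrow> 'w \<Rightarrow> real set) \<Rightarrow> real \<Rightarrow> 'w \<Rightarrow> nat \<Rightarrow> 'e \<Rightarrow> nat" where
  "ring_count T \<delta> \<omega> i e = rings (T e) (\<delta> * real (Suc i)) \<omega> - rings (T e) (\<delta> * real i) \<omega>"

definition discrete_perm ::
    "'a set set \<Rightarrow> ('a set \<Rightarrow> 'w \<Rightarrow> real set) \<Rightarrow> real \<Rightarrow> nat \<Rightarrow> 'w \<Rightarrow> 'a \<Rightarrow> 'a" where
  "discrete_perm E T \<delta> N \<omega> = walk (\<lambda>i. sole_ring E (ring_count T \<delta> \<omega> i)) N"

lemma discrete_perm_permutes: "finite_graph V E \<Longrightarrow> discrete_perm E T \<delta> N \<omega> permutes V"
  unfolding discrete_perm_def by (rule walk_permutes[OF _ sole_ring_range])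

section \<open>Agreement of the discretised and the exact permutation\<close>

lemma rings_diff:
  assumes "finite (T \<omega> \<inter> {..t})" "s \<le> t"
  shows "rings T t \<omega> - rings T s \<omega> = card (T \<omega> \<inter> {s<..t})"
proof -
  have "T \<omega> \<inter> {s<..t} = (T \<omega> \<inter> {..t}) - (T \<omega> \<inter> {..s})" by auto
  moreover have sub: "T \<omega> \<inter> {..s} \<subseteq> T \<omega> \<inter> {..t}" using assms(2) by auto
  ultimately show ?thesis
    using card_Diff_subset[OF finite_subset[OF sub assms(1)] sub] by (simp add: rings_def)
qed

text \<open>The hypothesis \<open>gap\<close> allows at most one ring in all between
  \<open>s\<close> and \<open>t\<close>. Without a ring nothing changes; with one, disjointness of
  the clocks determines its edge, which is the one \<open>sole_ring\<close> reports.\<close>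

lemma exclusion_perm_step:
  assumes fin: "finite E" "\<And>e. e \<in> E \<Longrightarrow> finite (T e \<omega> \<inter> {..t})"
    and disj: "disjoint_family_on (\<lambda>e. T e \<omega>) E"
    and st: "s \<le> t"
    and gap: "\<And>r r'. r \<in> (\<Union>e\<in>E. T e \<omega> \<inter> {s<..t}) \<Longrightarrow> r' \<in> (\<Union>e\<in>E. T e \<omega> \<inter> {s<..t}) \<Longrightarrow> r = r'"
  shows "exclusion_perm E T t \<omega> =
    (case sole_ring E (\<lambda>e. rings (T e) t \<omega> - rings (T e) s \<omega>) of None \<Rightarrow> id | Some e \<Rightarrow> edge_swap e)
      \<circ> exclusion_perm E T s \<omega>"
proof -
  let ?A = "\<lambda>t. \<Union>e\<in>E. T e \<omega> \<inter> {..t}" and ?B = "\<Union>e\<in>E. T e \<omega> \<inter> {s<..t}"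
  have At: "?A t = ?A s \<union> ?B" using st by force
  have count: "rings (T e) t \<omega> - rings (T e) s \<omega> = card (T e \<omega> \<inter> {s<..t})" if "e \<in> E" for e
    by (rule rings_diff) (use fin that st in auto)
  have finA: "finite (?A s)"
  proof (rule finite_subset)
    show "?A s \<subseteq> ?A t" using st by force
    show "finite (?A t)" by (intro finite_UN_I fin)
  qed
  show ?thesis
  proof (cases "?B = {}")
    case True
    then have "T e \<omega> \<inter> {s<..t} = {}" if "e \<in> E" for e using that by blast
    then have 0: "rings (T e) t \<omega> - rings (T e) s \<omega> = 0" if "e \<in> E" for e
      using that count by (metis card.empty)
    have "sole_ring E (\<lambda>e. rings (T e) t \<omega> - rings (T e) s \<omega>) \<noteq> Some e" for e
      unfolding sole_ring_eq_Some_iff using 0 by (metis zero_neq_one)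
    then have "sole_ring E (\<lambda>e. rings (T e) t \<omega> - rings (T e) s \<omega>) = None"
      by (rule not_Some_eq[THEN iffD1, OF allI])
    moreover have "?A t = ?A s" unfolding At True by simp
    ultimately show ?thesis by (simp only: exclusion_perm_def option.case id_comp)
  next
    case False
    then obtain r e where r: "e \<in> E" "r \<in> T e \<omega>" "s < r" "r \<le> t" by auto
    then have rB: "r \<in> ?B" by auto
    have B: "?B = {r}"
      using rB gap[OF _ rB] by blast
    have uniq: "e' = e" if "e' \<in> E" "r \<in> T e' \<omega>" for e'
      using disjoint_family_onD[OF disj that(1) r(1)] that r by blast
    have "rings (T e') t \<omega> - rings (T e') s \<omega> = (if e' = e then 1 else 0)" if e': "e' \<in> E" for e'
    proof -
      have sub: "T e' \<omega> \<inter> {s<..t} \<subseteq> {r}"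
        using B e' by blast
      have "T e' \<omega> \<inter> {s<..t} = (if e' = e then {r} else {})"
      proof (cases "e' = e")
        case True
        then show ?thesis using sub r(2-4) by force
      next
        case False
        then have "r \<notin> T e' \<omega>" using uniq[OF e'] by blast
        with False sub show ?thesis by auto
      qed
      then show ?thesis unfolding count[OF e'] by simp
    qed
    then have "sole_ring E (\<lambda>e. rings (T e) t \<omega> - rings (T e) s \<omega>) = Some e"
      unfolding sole_ring_eq_Some_iff using r(1) by blast
    \<comment> \<open>The new ring is later than all those up to \<open>s\<close>, so it comes last
      in the list and \<open>fold\<close> composes its transposition on the left.\<close>
    moreover have "sorted_list_of_set (?A t) = sorted_list_of_set (?A s) @ [r]"
    proof (rule sorted_distinct_set_unique)
      show "sorted (sorted_list_of_set (?A s) @ [r])"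
        using finA r by (auto simp: sorted_append)
      show "distinct (sorted_list_of_set (?A s) @ [r])"
        using finA r by auto
      show "set (sorted_list_of_set (?A t)) = set (sorted_list_of_set (?A s) @ [r])"
        unfolding At B set_append set_sorted_list_of_set[OF finA]
        using finA by (subst set_sorted_list_of_set) simp_all
    qed simp_all
    moreover have "(THE e. e \<in> E \<and> r \<in> T e \<omega>) = e"
      by (rule the_equality) (use uniq r in blast)+
    ultimately show ?thesis
      by (simp only: exclusion_perm_def fold_append comp_apply fold.simps id_apply option.case)
  qed
qed

lemma finite_min_gap:
  fixes A :: "real set"
  assumes "finite A"
  obtains \<epsilon> where "0 < \<epsilon>" "\<And>r r'. r \<in> A \<Longrightarrow> r' \<in> A \<Longrightarrow> \<bar>r - r'\<bar> < \<epsilon> \<Longrightarrow> r = r'"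
proof -
  \<comment> \<open>The element 1 keeps the minimum meaningful and positive when \<open>A\<close>
    has fewer than two points.\<close>
  let ?D = "insert 1 ((\<lambda>(r, r'). \<bar>r - r'\<bar>) ` {(r, r') \<in> A \<times> A. r \<noteq> r'})"
  have fin: "finite ?D"
    using assms by (auto intro: finite_subset[of _ "A \<times> A"])
  show thesis
  proof (rule that[of "Min ?D"])
    show "0 < Min ?D" using fin by (subst Min_gr_iff) auto
    fix r r' assume *: "r \<in> A" "r' \<in> A" "\<bar>r - r'\<bar> < Min ?D"
    show "r = r'"
    proof (rule ccontr)
      assume "r \<noteq> r'"
      with * have "Min ?D \<le> \<bar>r - r'\<bar>" by (intro Min_le[OF fin]) auto
      with * show False by simp
    qed
  qed
qed

text \<open>For a fixed outcome there are finitely many ringing times up to \<open>t\<close>. Once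
  the mesh is below their smallest gap, every cell has at most one ring and no ring is discarded, so
  the permutations coincide exactly.\<close>

lemma eventually_discrete_perm:
  assumes fin: "finite E" "\<And>e. e \<in> E \<Longrightarrow> finite (T e \<omega> \<inter> {..t})"
    and pos: "\<And>e. e \<in> E \<Longrightarrow> T e \<omega> \<subseteq> {0<..}"
    and disj: "disjoint_family_on (\<lambda>e. T e \<omega>) E" and t: "0 < t"
  shows "\<forall>\<^sub>F N in sequentially. discrete_perm E T (t / N) N \<omega> = exclusion_perm E T t \<omega>"
proof -
  have "finite (\<Union>e\<in>E. T e \<omega> \<inter> {..t})" by (intro finite_UN_I fin)
  then obtain \<epsilon> where \<epsilon>: "0 < \<epsilon>"
    "\<And>r r'. r \<in> (\<Union>e\<in>E. T e \<omega> \<inter> {..t}) \<Longrightarrow> r' \<in> (\<Union>e\<in>E. T e \<omega> \<inter> {..t}) \<Longrightarrow> \<bar>r - r'\<bar> < \<epsilon> \<Longrightarrow> r = r'"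
    by (rule finite_min_gap) (rule that)
  have "(\<lambda>N. t / real N) \<longlonglongrightarrow> 0" by (rule lim_const_over_n)
  then have "\<forall>\<^sub>F N in sequentially. t / real N < \<epsilon>"
    using \<epsilon>(1) by (rule order_tendstoD(2))
  then show ?thesis
    \<comment> \<open>\<open>N = 0\<close> must be excluded: there \<open>t / N\<close> is 0 and the
      cells do not cover the interval.\<close>
    using eventually_gt_at_top[of 0]
  proof eventually_elim
    case (elim N)
    let ?\<delta> = "t / real N"
    have \<delta>: "0 < ?\<delta>" "?\<delta> * real N = t" using t elim by auto
    have "exclusion_perm E T (?\<delta> * real i) \<omega> = discrete_perm E T ?\<delta> i \<omega>" if "i \<le> N" for i
      using that
    proof (induction i)
      case 0
      \<comment> \<open>All rings occur at strictly positive times, so both permutations start from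
        the identity.\<close>
      have "(\<Union>e\<in>E. T e \<omega> \<inter> {..0}) = {}" using pos by force
      then show ?case by (simp add: exclusion_perm_def discrete_perm_def del: UN_simps)
    next
      case (Suc i)
      have le: "?\<delta> * real (Suc i) \<le> t"
        using Suc.prems \<delta> by (metis mult_left_mono of_nat_le_iff less_imp_le)
      have "exclusion_perm E T (?\<delta> * real (Suc i)) \<omega> =
        (case sole_ring E (\<lambda>e. rings (T e) (?\<delta> * real (Suc i)) \<omega> - rings (T e) (?\<delta> * real i) \<omega>)
          of None \<Rightarrow> id | Some e \<Rightarrow> edge_swap e) \<circ> exclusion_perm E T (?\<delta> * real i) \<omega>"
      proof (rule exclusion_perm_step)
        show "finite E" "disjoint_family_on (\<lambda>e. T e \<omega>) E" by fact+
        show "finite (T e \<omega> \<inter> {..?\<delta> * real (Suc i)})" if "e \<in> E" for e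
          by (rule finite_subset[OF _ fin(2)[OF that]]) (use le in auto)
        show "?\<delta> * real i \<le> ?\<delta> * real (Suc i)" using \<delta> by (intro mult_left_mono) auto
        fix r r'
        assume "r \<in> (\<Union>e\<in>E. T e \<omega> \<inter> {?\<delta> * real i<..?\<delta> * real (Suc i)})"
          "r' \<in> (\<Union>e\<in>E. T e \<omega> \<inter> {?\<delta> * real i<..?\<delta> * real (Suc i)})"
        \<comment> \<open>Two rings in the same half-open cell are less than its length apart, and
          that length is below the gap \<open>\<epsilon>\<close>.\<close>
        moreover have "?\<delta> * real (Suc i) - ?\<delta> * real i = ?\<delta>"
          by (simp only: of_nat_Suc distrib_left mult_1_right add_diff_cancel_right')
        ultimately show "r = r'" using le elim(1) by (intro \<epsilon>(2)) auto
      qed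
      with Suc show ?case by (simp add: discrete_perm_def ring_count_def[abs_def])
    qed
    from this[of N] \<delta>(2) show ?case by simp
  qed
qed

section \<open>Law of the discretised process\<close>

lemma measurable_nat_diff:
  fixes X Y :: "'w \<Rightarrow> nat"
  assumes "X \<in> measurable M (count_space UNIV)" "Y \<in> measurable M (count_space UNIV)"
  shows "(\<lambda>\<omega>. X \<omega> - Y \<omega>) \<in> measurable M (count_space UNIV)"
  by (rule measurable_compose_countable[OF _ assms(1)])
    (rule measurable_compose[OF assms(2)], simp)

section \<open>Independence and law of the ring counts\<close>

locale exclusion_clocks = prob_space M
  for M :: "'w measure" and V :: "'a set" and E :: "'a set set" and \<alpha> :: real
    and T :: "'a set \<Rightarrow> 'w \<Rightarrow> real set" +
  assumes graph: "finite_graph V E" and rate_pos: "0 < \<alpha>" and clocks: "poisson_clocks M \<alpha> E T"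
begin

lemma finite_V: "finite V" and finite_E: "finite E"
  using graph finite_graph_edges by (auto simp: finite_graph_def)

lemma indep_trajectories: "indep_vars (\<lambda>_. trajectory_space) (\<lambda>e. trajectory (T e)) E"
  using clocks by (simp add: poisson_clocks_def)

lemma trajectory_measurable: "e \<in> E \<Longrightarrow> trajectory (T e) \<in> measurable M trajectory_space"
  using indep_trajectories by (simp add: indep_vars_def)

lemma rings_measurable:
  assumes "e \<in> E" "0 \<le> t"
  shows "rings (T e) t \<in> measurable M (count_space UNIV)"
proof -
  have "(\<lambda>\<omega>. trajectory (T e) \<omega> t) \<in> measurable M (count_space UNIV)"
    using assms by (intro measurable_compose[OF trajectory_measurable]
        measurable_component_singleton) auto
  then show ?thesis using assms by (simp add: trajectory_def)
qed

lemma ring_count_measurable: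
  "e \<in> E \<Longrightarrow> 0 \<le> \<delta> \<Longrightarrow> (\<lambda>\<omega>. ring_count T \<delta> \<omega> i e) \<in> measurable M (count_space UNIV)"
  unfolding ring_count_def by (intro measurable_nat_diff rings_measurable) auto

lemma indep_ring_count_edge:
  assumes "e \<in> E" "0 \<le> \<delta>"
  shows "indep_vars (\<lambda>_. count_space UNIV) (\<lambda>i \<omega>. ring_count T \<delta> \<omega> i e) UNIV"
proof -
  have "\<forall>t. incseq t \<and> 0 \<le> t 0 \<longrightarrow> indep_vars (\<lambda>_. count_space UNIV)
          (\<lambda>i \<omega>. rings (T e) (t (Suc i)) \<omega> - rings (T e) (t i) \<omega>) (UNIV :: nat set)"
    using clocks assms(1) by (simp add: poisson_clocks_def poisson_clock_def)
  moreover have "incseq (\<lambda>i. \<delta> * real i)"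
    using assms(2) by (auto simp: incseq_def intro: mult_left_mono)
  ultimately show ?thesis unfolding ring_count_def by auto
qed

text \<open>Two sources of independence are combined: whole trajectories are independent across
  edges, and increments are independent along one edge. The probability of a box factors first over
  edges, then over cells.\<close>

lemma indep_ring_count:
  assumes \<delta>: "0 \<le> \<delta>"
  shows "indep_vars (\<lambda>_. count_space UNIV) (\<lambda>(i, e) \<omega>. ring_count T \<delta> \<omega> i e) ({..<N} \<times> E)"
proof (cases "{..<N} \<times> E = {}")
  \<comment> \<open>The product criterion used in the other case is for nonempty index sets; an
    empty family is independent by definition.\<close>
  case True
  show ?thesis unfolding True by (simp add: indep_vars_def indep_sets_def)
next
  case False
  then have ne: "{..<N} \<noteq> {}" "E \<noteq> {}" by auto
  let ?X = "\<lambda>(i, e) \<omega>. ring_count T \<delta> \<omega> i e"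
  have "indep_vars (\<lambda>_. count_space UNIV) ?X ({..<N} \<times> E) \<longleftrightarrow>
    (\<forall>A\<in>(\<Pi> j\<in>{..<N} \<times> E. UNIV). prob (\<Inter>j\<in>{..<N} \<times> E. ?X j -` A j \<inter> space M)
       = (\<Prod>j\<in>{..<N} \<times> E. prob (?X j -` A j \<inter> space M)))"
    using False finite_E ring_count_measurable \<delta>
    by (intro indep_vars_finite) (auto simp: Int_stable_def intro: sigma_sets.Basic)
  also have "\<dots>"
  proof
    fix A :: "nat \<times> 'a set \<Rightarrow> nat set"
    \<comment> \<open>All constraints on the counts of edge \<open>e\<close> are gathered into a
      single event about its trajectory, so that independence of trajectories applies.\<close>
    define B where "B e = {y \<in> space trajectory_space.
      \<forall>i\<in>{..<N}. y (\<delta> * real (Suc i)) - y (\<delta> * real i) \<in> A (i, e)}" for e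
    have B: "B e \<in> sets trajectory_space" for e
    proof -
      have "(\<lambda>y. y (\<delta> * real (Suc i)) - y (\<delta> * real i)) \<in> measurable trajectory_space (count_space UNIV)" for i
        using \<delta> by (intro measurable_nat_diff measurable_component_singleton) auto
      then have "{y \<in> space trajectory_space. y (\<delta> * real (Suc i)) - y (\<delta> * real i) \<in> A (i, e)}
          \<in> sets trajectory_space" for i
        by (rule measurable_sets_Collect) simp
      then show ?thesis
        unfolding B_def by (intro sets.sets_Collect_finite_All) auto
    qed
    have pre: "trajectory (T e) -` B e \<inter> space M
        = (\<Inter>i\<in>{..<N}. (\<lambda>\<omega>. ring_count T \<delta> \<omega> i e) -` A (i, e) \<inter> space M)" if "e \<in> E" for e
    proof -
      have "trajectory (T e) \<omega> \<in> space trajectory_space" if "\<omega> \<in> space M" for \<omega>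
        using trajectory_measurable[OF \<open>e \<in> E\<close>] that by (rule measurable_space)
      moreover have "trajectory (T e) \<omega> (\<delta> * real i) = rings (T e) (\<delta> * real i) \<omega>" for i \<omega>
        using \<delta> by (simp add: trajectory_def)
      ultimately show ?thesis
        using ne(1) by (auto simp: B_def ring_count_def simp del: of_nat_Suc)
    qed
    have "(\<Inter>j\<in>{..<N} \<times> E. ?X j -` A j \<inter> space M) = (\<Inter>e\<in>E. trajectory (T e) -` B e \<inter> space M)"
      using ne by (auto simp: pre)
    also have "prob \<dots> = (\<Prod>e\<in>E. prob (trajectory (T e) -` B e \<inter> space M))"
      by (rule indep_varsD[OF indep_trajectories ne(2) finite_E]) (auto intro: B)
    also have "\<dots> = (\<Prod>e\<in>E. \<Prod>i\<in>{..<N}. prob ((\<lambda>\<omega>. ring_count T \<delta> \<omega> i e) -` A (i, e) \<inter> space M))"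
    proof (intro prod.cong refl)
      fix e assume e: "e \<in> E"
      show "prob (trajectory (T e) -` B e \<inter> space M)
          = (\<Prod>i\<in>{..<N}. prob ((\<lambda>\<omega>. ring_count T \<delta> \<omega> i e) -` A (i, e) \<inter> space M))"
        unfolding pre[OF e] by (rule indep_varsD[OF indep_ring_count_edge[OF e \<delta>] ne(1)]) auto
    qed
    also have "\<dots> = (\<Prod>j\<in>{..<N} \<times> E. prob (?X j -` A j \<inter> space M))"
      by (subst prod.swap) (simp add: prod.cartesian_product case_prod_beta)
    finally show "prob (\<Inter>j\<in>{..<N} \<times> E. ?X j -` A j \<inter> space M)
       = (\<Prod>j\<in>{..<N} \<times> E. prob (?X j -` A j \<inter> space M))" .
  qed
  finally show ?thesis .
qed

lemma prob_ring_count: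
  assumes e: "e \<in> E" and \<delta>: "0 < \<delta>"
  shows "prob ((\<lambda>\<omega>. ring_count T \<delta> \<omega> i e) -` {k} \<inter> space M) = (\<alpha> * \<delta>) ^ k / fact k * exp (- (\<alpha> * \<delta>))"
proof -
  have "\<delta> * real i < \<delta> * real (Suc i)" "0 \<le> \<delta> * real i"
    using \<delta> by simp_all
  then have "distr M (count_space UNIV) (\<lambda>\<omega>. rings (T e) (\<delta> * real (Suc i)) \<omega> - rings (T e) (\<delta> * real i) \<omega>)
      = measure_pmf (poisson_pmf (\<alpha> * (\<delta> * real (Suc i) - \<delta> * real i)))"
    using clocks e unfolding poisson_clocks_def poisson_clock_def by blast
  also have "\<delta> * real (Suc i) - \<delta> * real i = \<delta>"
    by (simp add: algebra_simps)
  finally have "distr M (count_space UNIV) (\<lambda>\<omega>. ring_count T \<delta> \<omega> i e) = measure_pmf (poisson_pmf (\<alpha> * \<delta>))"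
    unfolding ring_count_def .
  then have "measure (distr M (count_space UNIV) (\<lambda>\<omega>. ring_count T \<delta> \<omega> i e)) {k} = pmf (poisson_pmf (\<alpha> * \<delta>)) k"
    by (simp add: measure_pmf_single)
  then show ?thesis
    using \<delta> rate_pos ring_count_measurable[OF e, of \<delta> i] by (simp add: measure_distr)
qed

text \<open>The probability that a given edge rings once in a cell and all others are silent. Every
  one of the \<open>card E\<close> edges contributes \<open>exp (- (\<alpha> * \<delta>))\<close>,
  the ringing one a further \<open>\<alpha> * \<delta>\<close>.\<close>

definition swap_prob :: "real \<Rightarrow> real" where
  "swap_prob \<delta> = \<alpha> * \<delta> * exp (- (\<alpha> * \<delta>)) ^ card E"

lemma prob_sole_ring:
  assumes e: "e \<in> E" and \<delta>: "0 < \<delta>"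
  shows "prob {\<omega> \<in> space M. sole_ring E (ring_count T \<delta> \<omega> i) = Some e} = swap_prob \<delta>"
proof -
  let ?X = "\<lambda>(i, e) \<omega>. ring_count T \<delta> \<omega> i e"
  let ?k = "\<lambda>e'. if e' = e then 1 else 0 :: nat"
  have "{\<omega> \<in> space M. sole_ring E (ring_count T \<delta> \<omega> i) = Some e}
      = (\<Inter>j\<in>{i} \<times> E. ?X j -` {?k (snd j)} \<inter> space M)"
  proof (intro equalityI subsetI)
    fix \<omega> assume "\<omega> \<in> {\<omega> \<in> space M. sole_ring E (ring_count T \<delta> \<omega> i) = Some e}"
    then show "\<omega> \<in> (\<Inter>j\<in>{i} \<times> E. ?X j -` {?k (snd j)} \<inter> space M)"
      unfolding sole_ring_eq_Some_iff by simp
  next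
    fix \<omega> assume "\<omega> \<in> (\<Inter>j\<in>{i} \<times> E. ?X j -` {?k (snd j)} \<inter> space M)"
    then have *: "\<omega> \<in> ?X (i, e') -` {?k (snd (i, e'))} \<inter> space M" if "e' \<in> E" for e'
      by (rule INT_D) (use that in simp)
    then have "ring_count T \<delta> \<omega> i e' = ?k e'" if "e' \<in> E" for e'
      using that by fastforce
    moreover have "\<omega> \<in> space M" using *[OF e] by blast
    ultimately show "\<omega> \<in> {\<omega> \<in> space M. sole_ring E (ring_count T \<delta> \<omega> i) = Some e}"
      unfolding sole_ring_eq_Some_iff using e by blast
  qed
  also have "prob \<dots> = (\<Prod>j\<in>{i} \<times> E. prob (?X j -` {?k (snd j)} \<inter> space M))"
    using e finite_E \<delta> by (intro indep_varsD[OF indep_ring_count[of \<delta> "Suc i"]]) auto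
  also have "\<dots> = (\<Prod>e'\<in>E. (\<alpha> * \<delta>) ^ ?k e' / fact (?k e') * exp (- (\<alpha> * \<delta>)))"
  proof -
    have "{i} \<times> E = Pair i ` E" by auto
    then show ?thesis
      by (simp add: prod.reindex inj_on_def prob_ring_count[OF _ \<delta>])
  qed
  also have "\<dots> = (\<Prod>e'\<in>E. if e' = e then \<alpha> * \<delta> else 1) * exp (- (\<alpha> * \<delta>)) ^ card E"
    unfolding prod.distrib prod_constant by (intro arg_cong2[where f="(*)"] prod.cong) auto
  also have "\<dots> = swap_prob \<delta>"
    using e finite_E by (simp add: swap_prob_def)
  finally show ?thesis .
qed

section \<open>The discretised permutation as a lazy walk\<close>

abbreviation (input) "W \<equiv> discrete_perm E T"

text \<open>The permutation factors through the finite vector of counts in the first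
  \<open>N\<close> cells; its measurability and independence are read off from this.\<close>

lemma W_cong_counts:
  assumes "\<And>i e. i < N \<Longrightarrow> e \<in> E \<Longrightarrow> y (i, e) = ring_count T \<delta> \<omega> i e"
  shows "walk (\<lambda>i. sole_ring E (\<lambda>e. y (i, e))) N = W \<delta> N \<omega>"
  unfolding discrete_perm_def using assms by (intro walk_cong sole_ring_cong) auto

text \<open>A finite product of countable discrete spaces is discrete, so every function of the
  counts is measurable.\<close>

lemma PiM_counts:
  "finite I \<Longrightarrow> PiM I (\<lambda>_. count_space (UNIV :: nat set)) = count_space (PiE I (\<lambda>_. UNIV))"
  by (rule count_space_PiM_finite) simp_all

lemma W_measurable:
  fixes h :: "('a \<Rightarrow> 'a) \<Rightarrow> real"
  assumes \<delta>: "0 \<le> \<delta>"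
  shows "(\<lambda>\<omega>. h (W \<delta> N \<omega>)) \<in> borel_measurable M"
proof -
  let ?I = "{..<N} \<times> E"
  have "(\<lambda>\<omega>. \<lambda>j\<in>?I. ring_count T \<delta> \<omega> (fst j) (snd j)) \<in> measurable M (PiM ?I (\<lambda>_. count_space UNIV))"
    using \<delta> by (intro measurable_restrict ring_count_measurable) auto
  then have "(\<lambda>\<omega>. \<lambda>j\<in>?I. ring_count T \<delta> \<omega> (fst j) (snd j)) \<in> measurable M (count_space (PiE ?I (\<lambda>_. UNIV)))"
    using finite_E by (simp add: PiM_counts)
  from measurable_compose[OF this, of "\<lambda>y. h (walk (\<lambda>i. sole_ring E (\<lambda>e. y (i, e))) N)" borel]
  have "(\<lambda>\<omega>. h (walk (\<lambda>i. sole_ring E (\<lambda>e. (\<lambda>j\<in>?I. ring_count T \<delta> \<omega> (fst j) (snd j)) (i, e))) N))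
      \<in> borel_measurable M" by simp
  also have "(\<lambda>\<omega>. h (walk (\<lambda>i. sole_ring E (\<lambda>e. (\<lambda>j\<in>?I. ring_count T \<delta> \<omega> (fst j) (snd j)) (i, e))) N))
      = (\<lambda>\<omega>. h (W \<delta> N \<omega>))"
    by (intro ext arg_cong[where f=h] W_cong_counts) auto
  finally show ?thesis .
qed

lemma W_integrable:
  fixes h :: "('a \<Rightarrow> 'a) \<Rightarrow> real"
  assumes \<delta>: "0 \<le> \<delta>"
  shows "integrable M (\<lambda>\<omega>. h (W \<delta> N \<omega>))"
proof (rule integrable_const_bound[OF _ W_measurable[OF \<delta>]])
  let ?F = "{w. w permutes V}"
  \<comment> \<open>\<open>V\<close> has finitely many permutations, so any real function of
    \<open>W\<close> is bounded.\<close>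
  have "\<bar>h (W \<delta> N \<omega>)\<bar> \<le> Max ((\<lambda>w. \<bar>h w\<bar>) ` ?F)" for \<omega>
    by (intro Max_ge finite_imageI finite_permutations[OF finite_V] imageI)
      (simp add: discrete_perm_permutes[OF graph])
  then show "AE \<omega> in M. norm (h (W \<delta> N \<omega>)) \<le> Max ((\<lambda>w. \<bar>h w\<bar>) ` ?F)" by simp
qed

text \<open>\<open>W \<delta> N\<close> uses only the cells below \<open>N\<close>, whereas the
  indicator looks at cell \<open>N\<close>; the two blocks of counts are disjoint and hence
  independent.\<close>

lemma expectation_indep_sole_ring:
  fixes h :: "('a \<Rightarrow> 'a) \<Rightarrow> real"
  assumes e: "e \<in> E" and \<delta>: "0 < \<delta>"
  shows "expectation (\<lambda>\<omega>. h (W \<delta> N \<omega>) * (if sole_ring E (ring_count T \<delta> \<omega> N) = Some e then 1 else 0))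
       = expectation (\<lambda>\<omega>. h (W \<delta> N \<omega>)) * swap_prob \<delta>"
    (is "?lhs = ?rhs")
    and "integrable M (\<lambda>\<omega>. h (W \<delta> N \<omega>) * (if sole_ring E (ring_count T \<delta> \<omega> N) = Some e then 1 else 0))"
proof -
  let ?X = "\<lambda>(i, e) \<omega>. ring_count T \<delta> \<omega> i e"
  let ?A = "{..<N} \<times> E" and ?B = "{N} \<times> E"
  let ?h = "\<lambda>y. h (walk (\<lambda>i. sole_ring E (\<lambda>e. y (i, e))) N)"
  let ?g = "\<lambda>y. if sole_ring E (\<lambda>e. y (N, e)) = Some e then 1 else 0 :: real"
  let ?Z = "\<lambda>\<omega>. if sole_ring E (ring_count T \<delta> \<omega> N) = Some e then 1 else 0 :: real"
  have "indep_var (PiM ?A (\<lambda>_. count_space UNIV)) (\<lambda>\<omega>. restrict (\<lambda>i. ?X i \<omega>) ?A)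
      (PiM ?B (\<lambda>_. count_space UNIV)) (\<lambda>\<omega>. restrict (\<lambda>i. ?X i \<omega>) ?B)"
    by (rule indep_var_restrict[OF indep_ring_count[of \<delta> "Suc N"]]) (use \<delta> in auto)
  then have "indep_var borel (?h \<circ> (\<lambda>\<omega>. restrict (\<lambda>i. ?X i \<omega>) ?A))
      borel (?g \<circ> (\<lambda>\<omega>. restrict (\<lambda>i. ?X i \<omega>) ?B))"
    using finite_E by (intro indep_var_compose) (auto simp: PiM_counts)
  also have "?h \<circ> (\<lambda>\<omega>. restrict (\<lambda>i. ?X i \<omega>) ?A) = (\<lambda>\<omega>. h (W \<delta> N \<omega>))"
    unfolding comp_def by (intro ext arg_cong[where f=h] W_cong_counts) auto
  also have "?g \<circ> (\<lambda>\<omega>. restrict (\<lambda>i. ?X i \<omega>) ?B) = ?Z"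
  proof
    fix \<omega>
    have "sole_ring E (\<lambda>e. restrict (\<lambda>i. ?X i \<omega>) ?B (N, e)) = sole_ring E (ring_count T \<delta> \<omega> N)"
      by (rule sole_ring_cong) simp
    then show "(?g \<circ> (\<lambda>\<omega>. restrict (\<lambda>i. ?X i \<omega>) ?B)) \<omega> = ?Z \<omega>" by simp
  qed
  finally have ind: "indep_var borel (\<lambda>\<omega>. h (W \<delta> N \<omega>)) borel ?Z" .
  have Zm: "?Z \<in> borel_measurable M"
    using ind by (rule indep_var_rv2)
  have intZ: "integrable M ?Z"
    by (rule integrable_const_bound[of _ 1]) (use Zm in auto)
  have intW: "integrable M (\<lambda>\<omega>. h (W \<delta> N \<omega>))"
    using \<delta> by (intro W_integrable) simp
  have "{\<omega> \<in> space M. sole_ring E (ring_count T \<delta> \<omega> N) = Some e} = {\<omega> \<in> space M. ?Z \<omega> = 1}"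
    by auto
  also have "\<dots> \<in> events"
    by (rule measurable_sets_Collect[OF Zm]) simp
  finally have "{\<omega> \<in> space M. sole_ring E (ring_count T \<delta> \<omega> N) = Some e} \<in> events" .
  then have "expectation (indicator {\<omega> \<in> space M. sole_ring E (ring_count T \<delta> \<omega> N) = Some e})
      = swap_prob \<delta>"
    using prob_sole_ring[OF e \<delta>] by (simp add: emeasure_eq_measure)
  also have "expectation (indicator {\<omega> \<in> space M. sole_ring E (ring_count T \<delta> \<omega> N) = Some e})
      = expectation ?Z"
    by (intro Bochner_Integration.integral_cong) (auto simp: indicator_def)
  finally show "?lhs = ?rhs"
    using indep_var_lebesgue_integral[OF ind intW intZ] by simp
  show "integrable M (\<lambda>\<omega>. h (W \<delta> N \<omega>) * ?Z \<omega>)"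
    by (rule indep_var_integrable[OF ind intW intZ])
qed

text \<open>The last step is written as a sum over edges of the change in \<open>h\<close> times the
  indicator that this edge is the sole ring. At most one indicator is nonzero, and by independence
  each can be replaced by \<open>swap_prob \<delta>\<close>.\<close>

lemma expectation_W_Suc:
  fixes h :: "('a \<Rightarrow> 'a) \<Rightarrow> real"
  assumes \<delta>: "0 < \<delta>"
  shows "expectation (\<lambda>\<omega>. h (W \<delta> (Suc N) \<omega>)) = expectation (\<lambda>\<omega>. h (W \<delta> N \<omega>)
    + swap_prob \<delta> * (\<Sum>e\<in>E. h (edge_swap e \<circ> W \<delta> N \<omega>) - h (W \<delta> N \<omega>)))"
proof -
  let ?Z = "\<lambda>e \<omega>. if sole_ring E (ring_count T \<delta> \<omega> N) = Some e then 1 else 0 :: real"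
  let ?d = "\<lambda>e w. h (edge_swap e \<circ> w) - h w"
  have "h (W \<delta> (Suc N) \<omega>) = h (W \<delta> N \<omega>) + (\<Sum>e\<in>E. ?d e (W \<delta> N \<omega>) * ?Z e \<omega>)" for \<omega>
  proof (cases "sole_ring E (ring_count T \<delta> \<omega> N)")
    case None
    then show ?thesis by (simp add: discrete_perm_def)
  next
    case (Some e)
    then have e: "e \<in> E" by (simp add: sole_ring_eq_Some_iff)
    have "(\<Sum>e'\<in>E. ?d e' (W \<delta> N \<omega>) * ?Z e' \<omega>) = (\<Sum>e'\<in>E. if e = e' then ?d e' (W \<delta> N \<omega>) else 0)"
      using Some by (intro sum.cong) auto
    also have "\<dots> = ?d e (W \<delta> N \<omega>)" using e finite_E by (simp only: sum.delta' if_True)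
    finally show ?thesis using Some by (simp add: discrete_perm_def)
  qed
  then have "expectation (\<lambda>\<omega>. h (W \<delta> (Suc N) \<omega>))
      = expectation (\<lambda>\<omega>. h (W \<delta> N \<omega>)) + (\<Sum>e\<in>E. expectation (\<lambda>\<omega>. ?d e (W \<delta> N \<omega>)) * swap_prob \<delta>)"
    using \<delta> expectation_indep_sole_ring[where h="?d e" and e=e for e] W_integrable[of \<delta> h]
    by (simp add: Bochner_Integration.integral_sum Bochner_Integration.integral_add)
  also have "\<dots> = expectation (\<lambda>\<omega>. h (W \<delta> N \<omega>)
      + swap_prob \<delta> * (\<Sum>e\<in>E. h (edge_swap e \<circ> W \<delta> N \<omega>) - h (W \<delta> N \<omega>)))"
    using \<delta> W_integrable[of \<delta> h] W_integrable[of \<delta> "?d e" for e]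
    by (simp add: Bochner_Integration.integral_sum Bochner_Integration.integral_add
        sum_distrib_left mult.commute del: Bochner_Integration.integral_diff)
  finally show ?thesis .
qed

lemma expectation_W_images:
  assumes \<delta>: "0 < \<delta>"
  shows "expectation (\<lambda>\<omega>. \<Sum>S\<in>Pow V. a S * b (W \<delta> N \<omega> ` S))
    = (\<Sum>S\<in>Pow V. a S * (swap_step E (\<lambda>e. (`) (edge_swap e)) (swap_prob \<delta>) ^^ N) b S)"
proof (induction N arbitrary: b)
  case 0
  then show ?case by (simp add: discrete_perm_def prob_space)
next
  case (Suc N)
  let ?K = "swap_step E (\<lambda>e. (`) (edge_swap e)) (swap_prob \<delta>)"
  let ?h = "\<lambda>b w. \<Sum>S\<in>Pow V. a S * b (w ` S)"
  have "?h b w + swap_prob \<delta> * (\<Sum>e\<in>E. ?h b (edge_swap e \<circ> w) - ?h b w) = ?h (?K b) w" for w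
  proof -
    have "(\<Sum>e\<in>E. ?h b (edge_swap e \<circ> w) - ?h b w)
        = (\<Sum>S\<in>Pow V. a S * (\<Sum>e\<in>E. b (edge_swap e ` w ` S) - b (w ` S)))"
      unfolding sum_distrib_left sum_subtractf[symmetric] right_diff_distrib[symmetric]
      by (subst sum.swap) (simp add: image_comp)
    then show ?thesis
      by (simp only: swap_step_def distrib_left sum.distrib sum_distrib_left[where r="swap_prob \<delta>"]
          mult.left_commute)
  qed
  then have "expectation (\<lambda>\<omega>. ?h b (W \<delta> (Suc N) \<omega>)) = expectation (\<lambda>\<omega>. ?h (?K b) (W \<delta> N \<omega>))"
    using expectation_W_Suc[OF \<delta>, of "?h b" N] by simp
  also have "\<dots> = (\<Sum>S\<in>Pow V. a S * (?K ^^ Suc N) b S)"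
    unfolding Suc.IH by (simp only: funpow_Suc_right comp_apply)
  finally show ?case .
qed

end

section \<open>The exclusion process in the Fourier basis\<close>

lemma config_permute:
  assumes "w permutes V" "\<xi> \<in> configs V"
  shows "(\<lambda>x. \<xi> (inv w x)) \<in> configs V"
  using assms permutes_in_image[OF permutes_inv[OF assms(1)]] by (auto simp: configs_def PiE_iff extensional_def)

lemma walsh_permute:
  assumes "w permutes V"
  shows "walsh S (\<lambda>x. \<xi> (inv w x)) = walsh (inv w ` S) \<xi>"
  unfolding walsh_def
  by (subst prod.reindex) (simp_all add: permutes_inj_on[OF permutes_inv[OF assms]])

lemma expectation_permute_fourier:
  assumes V: "finite V" and w: "w permutes V"
  shows "measure_pmf.expectation (pmf_of_set (configs V)) (\<lambda>\<xi>. f \<xi> * f (\<lambda>x. \<xi> (inv w x)))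
       = (\<Sum>S\<in>Pow V. fourier V f S * fourier V f (w ` S))"
proof -
  have "f (\<lambda>x. \<xi> (inv w x)) = (\<Sum>S\<in>Pow V. fourier V f S * walsh (inv w ` S) \<xi>)" if "\<xi> \<in> configs V" for \<xi>
    using fourier_inversion[OF V config_permute[OF w that], of f] by (simp add: walsh_permute[OF w])
  then have "measure_pmf.expectation (pmf_of_set (configs V)) (\<lambda>\<xi>. f \<xi> * f (\<lambda>x. \<xi> (inv w x)))
      = (\<Sum>S\<in>Pow V. fourier V f S * fourier V f (inv w ` S))"
    by (rule expectation_mult_eq_sum_fourier[OF V])
  also have "\<dots> = (\<Sum>S\<in>Pow V. fourier V f S * fourier V f (w ` S))"
  \<comment> \<open>Expanding the second factor produced the inverse permutation. Replacing
    \<open>S\<close> by its image under \<open>w\<close> moves the permutation itself onto the other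
    coefficient, as needed for \<open>expectation_W_images\<close>.\<close>
  proof (rule sum.reindex_bij_witness[of _ "(`) w" "(`) (inv w)"])
    fix S assume S: "S \<in> Pow V"
    show "inv w ` S \<in> Pow V" "w ` S \<in> Pow V"
      using S permutes_in_image[OF w] permutes_in_image[OF permutes_inv[OF w]] by auto
    show "w ` inv w ` S = S" "inv w ` w ` S = S"
      by (simp_all add: image_image permutes_inverses[OF w])
    then show "fourier V f (inv w ` S) * fourier V f (w ` inv w ` S) = fourier V f S * fourier V f (inv w ` S)"
      by simp
  qed
  finally show ?thesis .
qed

text \<open>Passes from independent sigma-algebras, the form in which the initial state and the
  clocks are declared independent, to random variables measurable with respect to them.\<close>

lemma (in prob_space) indep_var_of_indep_set:
  assumes indep: "indep_set (sets A) (sets B)"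
    and space: "space A = space M" "space B = space M"
    and X: "X \<in> measurable A N" and Y: "Y \<in> measurable B N'"
  shows "indep_var N X N' Y"
  unfolding indep_var_eq
proof (intro conjI)
  have sub: "sets A \<subseteq> events" "sets B \<subseteq> events"
    using indep unfolding indep_set_def indep_sets_def by (auto split: bool.splits)
  show "random_variable N X" "random_variable N' Y"
    using X Y sub space by (auto simp: measurable_def)
  have "sigma_sets (space M) {X -` S \<inter> space M |S. S \<in> sets N} \<subseteq> sets A"
    using measurable_sets[OF X] unfolding space(1)[symmetric] by (intro sets.sigma_sets_subset) auto
  moreover have "sigma_sets (space M) {Y -` S \<inter> space M |S. S \<in> sets N'} \<subseteq> sets B"
    using measurable_sets[OF Y] unfolding space(2)[symmetric] by (intro sets.sigma_sets_subset) auto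
  moreover have "indep_sets (case_bool (sets A) (sets B)) UNIV"
    using indep by (simp only: indep_set_def)
  ultimately show "indep_set (sigma_sets (space M) {X -` S \<inter> space M |S. S \<in> sets N})
      (sigma_sets (space M) {Y -` S \<inter> space M |S. S \<in> sets N'})"
    unfolding indep_set_def by (elim indep_sets_mono_sets) (simp split: bool.split)
qed

text \<open>Turns the clocks, existentially quantified in
  \<open>symmetric_exclusion_process\<close>, into a parameter \<open>T\<close>.\<close>

locale exclusion_process = exclusion_clocks M V E \<alpha> T
  for M :: "'w measure" and V :: "'a set" and E :: "'a set set" and \<alpha> :: real
    and T :: "'a set \<Rightarrow> 'w \<Rightarrow> real set" +
  fixes \<eta> :: "real \<Rightarrow> 'w \<Rightarrow> 'a \<Rightarrow> bool"
  assumes initial_measurable: "\<eta> 0 \<in> measurable M (count_space (configs V))"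
    and initial_distr: "distr M (count_space (configs V)) (\<eta> 0) = uniform_count_measure (configs V)"
    and initial_indep: "indep_set
          (sets (vimage_algebra (space M) (\<eta> 0) (count_space (configs V))))
          (sets (vimage_algebra (space M) (\<lambda>\<omega>. \<lambda>e\<in>E. trajectory (T e) \<omega>)
             (Pi\<^sub>M E (\<lambda>_. trajectory_space))))"
    and process_eq: "\<And>t \<omega>. 0 \<le> t \<Longrightarrow> \<omega> \<in> space M \<Longrightarrow>
          \<eta> t \<omega> = (\<lambda>x. \<eta> 0 \<omega> (inv (exclusion_perm E T t \<omega>) x))"
begin

lemma initial_config: "\<omega> \<in> space M \<Longrightarrow> \<eta> 0 \<omega> \<in> configs V"
  using measurable_space[OF initial_measurable] by simp

lemma expectation_initial:
  fixes g :: "_ \<Rightarrow> real"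
  shows "expectation (\<lambda>\<omega>. g (\<eta> 0 \<omega>)) = measure_pmf.expectation (pmf_of_set (configs V)) g"
proof -
  have "expectation (\<lambda>\<omega>. g (\<eta> 0 \<omega>)) = integral\<^sup>L (distr M (count_space (configs V)) (\<eta> 0)) g"
    by (rule integral_distr[OF initial_measurable, symmetric]) simp
  then show ?thesis
    by (simp add: initial_distr integral_uniform_count_measure integral_pmf_of_set
        finite_configs configs_nonempty finite_V)
qed

text \<open>The counts are increments of the trajectories, so \<open>W\<close> is measurable for the
  clock sigma-algebra, which is independent of the initial state. Indicators of single
  configurations suffice because \<open>configs V\<close> is finite.\<close>

lemma expectation_indep_initial:
  fixes h :: "('a \<Rightarrow> 'a) \<Rightarrow> real"
  assumes \<delta>: "0 \<le> \<delta>"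
  shows "expectation (\<lambda>\<omega>. (if \<eta> 0 \<omega> = \<xi> then 1 else 0) * h (W \<delta> N \<omega>))
       = expectation (\<lambda>\<omega>. if \<eta> 0 \<omega> = \<xi> then 1 else 0) * expectation (\<lambda>\<omega>. h (W \<delta> N \<omega>))"
    and "integrable M (\<lambda>\<omega>. (if \<eta> 0 \<omega> = \<xi> then 1 else 0) * h (W \<delta> N \<omega>))"
proof -
  let ?I = "{..<N} \<times> E"
  let ?traj = "\<lambda>\<omega>. \<lambda>e\<in>E. trajectory (T e) \<omega>"
  let ?counts = "\<lambda>y. \<lambda>(i, e)\<in>?I. y e (\<delta> * real (Suc i)) - y e (\<delta> * real i) :: nat"
  let ?g = "\<lambda>y. h (walk (\<lambda>i. sole_ring E (\<lambda>e. y (i, e))) N)"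
  let ?Z = "\<lambda>\<omega>. if \<eta> 0 \<omega> = \<xi> then 1 else 0 :: real"
  have comp: "(\<lambda>y. y e s) \<in> measurable (Pi\<^sub>M E (\<lambda>_. trajectory_space)) (count_space UNIV)"
    if "e \<in> E" "0 \<le> s" for e s
    by (rule measurable_compose[OF measurable_component_singleton[OF that(1)]])
      (rule measurable_component_singleton, use that(2) in simp)
  have "?counts \<in> measurable (Pi\<^sub>M E (\<lambda>_. trajectory_space)) (PiM ?I (\<lambda>_. count_space UNIV))"
    using \<delta> by (intro measurable_restrict) (auto intro!: measurable_nat_diff comp)
  then have "?counts \<in> measurable (Pi\<^sub>M E (\<lambda>_. trajectory_space)) (count_space (PiE ?I (\<lambda>_. UNIV)))"
    using finite_E by (simp add: PiM_counts)
  from measurable_compose[OF this, of ?g borel]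
  have "(\<lambda>y. ?g (?counts y)) \<in> borel_measurable (Pi\<^sub>M E (\<lambda>_. trajectory_space))" by simp
  moreover have "?traj \<in> measurable (vimage_algebra (space M) ?traj (Pi\<^sub>M E (\<lambda>_. trajectory_space)))
      (Pi\<^sub>M E (\<lambda>_. trajectory_space))"
  proof (rule measurable_vimage_algebra1)
    have "?traj \<in> measurable M (Pi\<^sub>M E (\<lambda>_. trajectory_space))"
      by (intro measurable_restrict trajectory_measurable)
    then show "?traj \<in> space M \<rightarrow> space (Pi\<^sub>M E (\<lambda>_. trajectory_space))"
      by (auto dest: measurable_space)
  qed
  ultimately have "(\<lambda>\<omega>. ?g (?counts (?traj \<omega>)))
      \<in> borel_measurable (vimage_algebra (space M) ?traj (Pi\<^sub>M E (\<lambda>_. trajectory_space)))"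
    by (rule measurable_compose[rotated])
  also have "(\<lambda>\<omega>. ?g (?counts (?traj \<omega>))) = (\<lambda>\<omega>. h (W \<delta> N \<omega>))"
    using \<delta> by (intro ext arg_cong[where f=h] W_cong_counts) (simp add: ring_count_def trajectory_def)
  finally have W: "(\<lambda>\<omega>. h (W \<delta> N \<omega>))
      \<in> borel_measurable (vimage_algebra (space M) ?traj (Pi\<^sub>M E (\<lambda>_. trajectory_space)))" .
  have "\<eta> 0 \<in> measurable (vimage_algebra (space M) (\<eta> 0) (count_space (configs V))) (count_space (configs V))"
    using initial_config by (intro measurable_vimage_algebra1) auto
  then have Z: "?Z \<in> borel_measurable (vimage_algebra (space M) (\<eta> 0) (count_space (configs V)))"
    by (rule measurable_compose) simp
  have ind: "indep_var borel ?Z borel (\<lambda>\<omega>. h (W \<delta> N \<omega>))"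
    by (rule indep_var_of_indep_set[OF initial_indep _ _ Z W]) simp_all
  have intZ: "integrable M ?Z"
    by (rule integrable_const_bound[of _ 1]) (use indep_var_rv1[OF ind] in auto)
  have intW: "integrable M (\<lambda>\<omega>. h (W \<delta> N \<omega>))"
    by (rule W_integrable[OF \<delta>])
  show "expectation (\<lambda>\<omega>. ?Z \<omega> * h (W \<delta> N \<omega>)) = expectation ?Z * expectation (\<lambda>\<omega>. h (W \<delta> N \<omega>))"
    by (rule indep_var_lebesgue_integral[OF ind intZ intW])
  show "integrable M (\<lambda>\<omega>. ?Z \<omega> * h (W \<delta> N \<omega>))"
    by (rule indep_var_integrable[OF ind intZ intW])
qed

text \<open>Splitting by the value of \<open>\<eta> 0\<close> and using independence, the
  expectation becomes a uniform average over configurations inside an expectation over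
  \<open>W\<close>. For each outcome that average is a sum of products of Fourier coefficients, to
  which the walk computation applies.\<close>

lemma expectation_discrete:
  fixes f :: "_ \<Rightarrow> real"
  assumes \<delta>: "0 < \<delta>"
  defines "a \<equiv> fourier V f"
  shows "integrable M (\<lambda>\<omega>. f (\<eta> 0 \<omega>) * f (\<lambda>x. \<eta> 0 \<omega> (inv (W \<delta> N \<omega>) x)))" (is ?int)
    and "expectation (\<lambda>\<omega>. f (\<eta> 0 \<omega>) * f (\<lambda>x. \<eta> 0 \<omega> (inv (W \<delta> N \<omega>) x)))
       = (\<Sum>S\<in>Pow V. a S * (swap_step E (\<lambda>e. (`) (edge_swap e)) (swap_prob \<delta>) ^^ N) a S)" (is ?eq)
proof -
  let ?h = "\<lambda>\<xi> w. f \<xi> * f (\<lambda>x. \<xi> (inv w x))"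
  let ?Z = "\<lambda>\<xi> \<omega>. if \<eta> 0 \<omega> = \<xi> then 1 else 0 :: real"
  let ?Q = "\<lambda>\<omega>. \<Sum>\<xi>\<in>configs V. ?Z \<xi> \<omega> * ?h \<xi> (W \<delta> N \<omega>)"
  have eq: "?h (\<eta> 0 \<omega>) (W \<delta> N \<omega>) = ?Q \<omega>" if "\<omega> \<in> space M" for \<omega>
  proof -
    have "?Q \<omega> = (\<Sum>\<xi>\<in>configs V. if \<eta> 0 \<omega> = \<xi> then ?h \<xi> (W \<delta> N \<omega>) else 0)"
      by (intro sum.cong) auto
    also have "\<dots> = ?h (\<eta> 0 \<omega>) (W \<delta> N \<omega>)"
      using initial_config[OF that] finite_configs[OF finite_V] by simp
    finally show ?thesis by simp
  qed
  have Z: "expectation (?Z \<xi>) = 1 / 2 ^ card V" if "\<xi> \<in> configs V" for \<xi>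
    using that expectation_initial[of "\<lambda>\<xi>'. if \<xi>' = \<xi> then 1 else 0"]
    by (simp add: expectation_configs finite_V finite_configs)
  have int: "integrable M (\<lambda>\<omega>. ?Z \<xi> \<omega> * ?h \<xi> (W \<delta> N \<omega>))" for \<xi>
    using \<delta> by (intro expectation_indep_initial(2)) simp
  have "integrable M ?Q" by (intro Bochner_Integration.integrable_sum int)
  then show ?int
    by (subst Bochner_Integration.integrable_cong[OF refl eq])
  have "expectation (\<lambda>\<omega>. ?h (\<eta> 0 \<omega>) (W \<delta> N \<omega>)) = expectation ?Q"
    by (rule Bochner_Integration.integral_cong[OF refl eq])
  also have "\<dots> = (\<Sum>\<xi>\<in>configs V. expectation (\<lambda>\<omega>. ?Z \<xi> \<omega> * ?h \<xi> (W \<delta> N \<omega>)))"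
    by (rule Bochner_Integration.integral_sum[OF int])
  also have "\<dots> = (\<Sum>\<xi>\<in>configs V. expectation (\<lambda>\<omega>. ?h \<xi> (W \<delta> N \<omega>)) / 2 ^ card V)"
    using \<delta> by (intro sum.cong refl, subst expectation_indep_initial(1)) (simp_all add: Z)
  also have "\<dots> = expectation (\<lambda>\<omega>. (\<Sum>\<xi>\<in>configs V. ?h \<xi> (W \<delta> N \<omega>)) / 2 ^ card V)"
    using \<delta> W_integrable[of \<delta> "?h \<xi>" for \<xi>] by (simp add: Bochner_Integration.integral_sum sum_divide_distrib)
  also have "\<dots> = expectation (\<lambda>\<omega>. \<Sum>S\<in>Pow V. a S * a (W \<delta> N \<omega> ` S))"
    unfolding a_def expectation_configs[OF finite_V, symmetric]
    by (simp only: expectation_permute_fourier[OF finite_V discrete_perm_permutes[OF graph]])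
  also have "\<dots> = (\<Sum>S\<in>Pow V. a S * (swap_step E (\<lambda>e. (`) (edge_swap e)) (swap_prob \<delta>) ^^ N) a S)"
    by (rule expectation_W_images[OF \<delta>])
  finally show ?eq .
qed

text \<open>For each outcome the discretised products are eventually equal to the exact one.
  Measurability at time \<open>t\<close> follows as that of a pointwise limit, and dominated
  convergence with bound 1 gives the limit of expectations.\<close>

lemma tendsto_discrete:
  assumes f: "f \<in> configs V \<rightarrow> {-1, 1 :: real}" and t: "0 < t"
  defines "D \<equiv> \<lambda>N \<omega>. f (\<eta> 0 \<omega>) * f (\<lambda>x. \<eta> 0 \<omega> (inv (W (t / real N) N \<omega>) x))"
  shows "(\<lambda>\<omega>. f (\<eta> 0 \<omega>) * f (\<eta> t \<omega>)) \<in> borel_measurable M" (is ?meas)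
    and "(\<lambda>N. expectation (D (Suc N))) \<longlonglongrightarrow> expectation (\<lambda>\<omega>. f (\<eta> 0 \<omega>) * f (\<eta> t \<omega>))" (is ?lim)
proof -
  have lim: "(\<lambda>N. D (Suc N) \<omega>) \<longlonglongrightarrow> f (\<eta> 0 \<omega>) * f (\<eta> t \<omega>)" if \<omega>: "\<omega> \<in> space M" for \<omega>
  proof -
    have "\<forall>\<^sub>F N in sequentially. W (t / real N) N \<omega> = exclusion_perm E T t \<omega>"
    proof (rule eventually_discrete_perm[OF finite_E _ _ _ t])
      show "disjoint_family_on (\<lambda>e. T e \<omega>) E"
        using clocks \<omega> by (simp add: poisson_clocks_def)
      show "finite (T e \<omega> \<inter> {..t})" "T e \<omega> \<subseteq> {0<..}" if "e \<in> E" for e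
        using clocks \<omega> that by (simp_all add: poisson_clocks_def poisson_clock_def)
    qed
    then have "\<forall>\<^sub>F N in sequentially. D N \<omega> = f (\<eta> 0 \<omega>) * f (\<eta> t \<omega>)"
    proof eventually_elim
      case (elim N)
      have "\<eta> t \<omega> = (\<lambda>x. \<eta> 0 \<omega> (inv (exclusion_perm E T t \<omega>) x))"
        using t \<omega> by (intro process_eq) auto
      then show ?case by (simp only: D_def elim)
    qed
    then have "(\<lambda>N. D N \<omega>) \<longlonglongrightarrow> f (\<eta> 0 \<omega>) * f (\<eta> t \<omega>)"
      by (rule tendsto_eventually)
    \<comment> \<open>The shift to \<open>Suc N\<close> keeps the mesh \<open>t / Suc N\<close>
      positive, which \<open>expectation_discrete\<close> requires.\<close>
    then show ?thesis by (rule LIMSEQ_Suc)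
  qed
  have meas: "D (Suc N) \<in> borel_measurable M" for N
    unfolding D_def by (intro borel_measurable_integrable expectation_discrete(1)) (use t in simp)
  show m: ?meas
    by (rule borel_measurable_LIMSEQ_real[OF lim meas])
  have bound: "\<bar>D N \<omega>\<bar> \<le> 1" if "\<omega> \<in> space M" for N \<omega>
  proof -
    have "\<bar>f \<xi>\<bar> = 1" if "\<xi> \<in> configs V" for \<xi> using funcset_mem[OF f that] by auto
    from this[OF initial_config[OF that]]
      this[OF config_permute[OF discrete_perm_permutes[OF graph, of T "t / real N" N \<omega>] initial_config[OF that]]]
    show ?thesis unfolding D_def abs_mult by simp
  qed
  show ?lim
    by (rule integral_dominated_convergence[where w="\<lambda>_. 1"])
      (use m meas lim bound in \<open>auto intro!: AE_I2\<close>)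
qed

text \<open>With \<open>N\<close> cells the swap probability is at most
  \<open>\<alpha> * t / N\<close>, so level k keeps at least the factor (1 - 2 t \<alpha> d k /
  N)^N, where d is the maximum degree. This tends to exp(-2 t \<alpha> d k), which is at least
  exp(-2 t)^k since \<alpha> d <= 1.\<close>

theorem expectation_process_ge:
  assumes f: "f \<in> configs V \<rightarrow> {-1, 1 :: real}" and t: "0 < t"
    and rate: "max_degree V E \<noteq> 0 \<Longrightarrow> \<alpha> \<le> 1 / real (max_degree V E)"
  shows "(\<Sum>S\<in>Pow V. exp (- (2 * t)) ^ card S * (fourier V f S)\<^sup>2)
       \<le> expectation (\<lambda>\<omega>. f (\<eta> 0 \<omega>) * f (\<eta> t \<omega>))"
proof -
  let ?d = "real (max_degree V E)"
  let ?x = "\<lambda>k. - (2 * t * (\<alpha> * ?d) * real k)"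
  let ?a = "fourier V f"
  \<comment> \<open>Without edges the product is 0, so the bound also covers the case in which the
    rate is unrestricted.\<close>
  have rate': "\<alpha> * ?d \<le> 1"
    using rate rate_pos by (cases "max_degree V E = 0") (auto simp: field_simps)
  have "exp (- (2 * t)) ^ card S \<le> exp (?x (card S))" for S :: "'a set"
  proof -
    have "2 * t * real (card S) * (\<alpha> * ?d) \<le> 2 * t * real (card S) * 1"
      using t by (intro mult_left_mono rate') auto
    then show ?thesis
      by (simp add: exp_of_nat_mult[symmetric] mult_ac)
  qed
  then have "(\<Sum>S\<in>Pow V. exp (- (2 * t)) ^ card S * (?a S)\<^sup>2) \<le> (\<Sum>S\<in>Pow V. exp (?x (card S)) * (?a S)\<^sup>2)"
    by (intro sum_mono mult_right_mono) auto
  also have "\<dots> \<le> expectation (\<lambda>\<omega>. f (\<eta> 0 \<omega>) * f (\<eta> t \<omega>))"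
  proof (rule tendsto_le[OF sequentially_bot tendsto_discrete(2)[OF f t]])
    show "(\<lambda>N. \<Sum>S\<in>Pow V. (1 + ?x (card S) / real (Suc N)) ^ Suc N * (?a S)\<^sup>2)
        \<longlonglongrightarrow> (\<Sum>S\<in>Pow V. exp (?x (card S)) * (?a S)\<^sup>2)"
      by (intro tendsto_sum tendsto_mult tendsto_const LIMSEQ_Suc[OF tendsto_exp_limit_sequentially])
    \<comment> \<open>Once this is below 1 at the largest level \<open>card V\<close>, all bases of
      the powers are nonnegative, and \<open>swap_prob\<close> meets the smallness condition of
      \<open>exclusion_step_quadratic_form\<close>.\<close>
    have "(\<lambda>N. - ?x (card V) / real (Suc N)) \<longlonglongrightarrow> 0"
      by (intro LIMSEQ_Suc[OF lim_const_over_n])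
    then have "\<forall>\<^sub>F N in sequentially. - ?x (card V) / real (Suc N) < 1"
      by (rule order_tendstoD(2)) simp
    then show "\<forall>\<^sub>F N in sequentially. (\<Sum>S\<in>Pow V. (1 + ?x (card S) / real (Suc N)) ^ Suc N * (?a S)\<^sup>2)
        \<le> expectation (\<lambda>\<omega>. f (\<eta> 0 \<omega>) * f (\<lambda>x. \<eta> 0 \<omega> (inv (W (t / real (Suc N)) (Suc N) \<omega>) x)))"
    proof eventually_elim
      case (elim N)
      let ?\<delta> = "t / real (Suc N)" and ?N = "Suc N"
      let ?p = "swap_prob ?\<delta>"
      have \<delta>: "0 < ?\<delta>" using t by simp
      have p: "0 \<le> ?p" "?p \<le> \<alpha> * ?\<delta>"
      proof -
        have \<alpha>\<delta>: "0 \<le> \<alpha> * ?\<delta>" using rate_pos \<delta> by (intro mult_nonneg_nonneg less_imp_le)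
        then show "0 \<le> ?p" unfolding swap_prob_def by (rule mult_nonneg_nonneg) simp
        have "exp (- (\<alpha> * ?\<delta>)) ^ card E \<le> 1" using \<alpha>\<delta> by (intro power_le_one) auto
        then show "?p \<le> \<alpha> * ?\<delta>" unfolding swap_prob_def by (rule mult_left_le[OF _ \<alpha>\<delta>])
      qed
      have cmp: "2 * ?p * real (max_degree V E * k) \<le> - ?x k / real ?N" for k
      proof -
        have "2 * ?p * real (max_degree V E * k) \<le> 2 * (\<alpha> * ?\<delta>) * real (max_degree V E * k)"
          using p by (intro mult_right_mono mult_left_mono) auto
        also have "\<dots> = - ?x k / real ?N" by (simp add: field_simps)
        finally show ?thesis .
      qed
      have "(\<Sum>S\<in>Pow V. (1 + ?x (card S) / real ?N) ^ ?N * (?a S)\<^sup>2)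
          \<le> (\<Sum>S\<in>Pow V. (1 - 2 * ?p * real (max_degree V E * card S)) ^ ?N * (?a S)\<^sup>2)"
      proof (intro sum_mono mult_right_mono power_mono)
        fix S assume S: "S \<in> Pow V"
        show "1 + ?x (card S) / real ?N \<le> 1 - 2 * ?p * real (max_degree V E * card S)"
          using cmp[of "card S"] by simp
        have "- ?x (card S) / real ?N \<le> - ?x (card V) / real ?N"
          using S t rate_pos finite_V card_mono[of V S]
          by (intro divide_right_mono) (auto intro!: mult_left_mono)
        with elim show "0 \<le> 1 + ?x (card S) / real ?N"
          unfolding minus_divide_left[symmetric] by linarith
      qed simp
      also have "\<dots> \<le> (\<Sum>S\<in>Pow V. ?a S * (swap_step E (\<lambda>e. (`) (edge_swap e)) ?p ^^ ?N) ?a S)"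
        by (rule exclusion_step_quadratic_form[OF graph p(1)]) (use cmp[of "card V"] elim in linarith)
      also have "\<dots> = expectation (\<lambda>\<omega>. f (\<eta> 0 \<omega>) * f (\<lambda>x. \<eta> 0 \<omega> (inv (W ?\<delta> ?N \<omega>) x)))"
        by (rule expectation_discrete(2)[OF \<delta>, symmetric])
      finally show ?case .
    qed
  qed
  finally show ?thesis .
qed

text \<open>That the exact permutation permutes \<open>V\<close> is inherited from a fine enough
  discretisation, with which it coincides.\<close>

lemma process_config:
  assumes "0 < t" "\<omega> \<in> space M"
  shows "\<eta> t \<omega> \<in> configs V"
proof -
  have "\<forall>\<^sub>F N in sequentially. W (t / real N) N \<omega> = exclusion_perm E T t \<omega>"
    using clocks assms by (intro eventually_discrete_perm finite_E) (auto simp: poisson_clocks_def poisson_clock_def)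
  then obtain N :: nat where "W (t / real N) N \<omega> = exclusion_perm E T t \<omega>"
    by (auto simp: eventually_sequentially)
  then have "exclusion_perm E T t \<omega> permutes V"
    using discrete_perm_permutes[OF graph] by metis
  moreover have "\<eta> t \<omega> = (\<lambda>x. \<eta> 0 \<omega> (inv (exclusion_perm E T t \<omega>) x))"
    using assms by (intro process_eq) auto
  ultimately show ?thesis
    using config_permute initial_config[OF assms(2)] by metis
qed

text \<open>For signs a and b the indicator of a being different from b is (1 - a b) / 2, so
  stability is a statement about correlations.\<close>

lemma prob_process_neq:
  assumes f: "f \<in> configs V \<rightarrow> {-1, 1 :: real}" and t: "0 < t"
  shows "prob {\<omega> \<in> space M. f (\<eta> 0 \<omega>) \<noteq> f (\<eta> t \<omega>)}
       = (1 - expectation (\<lambda>\<omega>. f (\<eta> 0 \<omega>) * f (\<eta> t \<omega>))) / 2"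
proof -
  let ?g = "\<lambda>\<omega>. f (\<eta> 0 \<omega>) * f (\<eta> t \<omega>)"
  let ?A = "{\<omega> \<in> space M. f (\<eta> 0 \<omega>) \<noteq> f (\<eta> t \<omega>)}"
  note meas = tendsto_discrete(1)[OF f t]
  have pm: "f (\<eta> 0 \<omega>) \<in> {-1, 1}" "f (\<eta> t \<omega>) \<in> {-1, 1}" if "\<omega> \<in> space M" for \<omega>
    using f initial_config[OF that] process_config[OF t that] by blast+
  have "?A = {\<omega> \<in> space M. ?g \<omega> = -1}"
    using pm by force
  also have "\<dots> \<in> events" by (rule measurable_sets_Collect[OF meas]) simp
  finally have A: "?A \<in> events" .
  have int: "integrable M ?g"
    by (rule integrable_const_bound[of _ 1])
      (use meas pm in \<open>auto intro!: AE_I2 simp: abs_mult, force\<close>)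
  have "prob ?A = expectation (indicator ?A)" using A by simp
  also have "\<dots> = expectation (\<lambda>\<omega>. (1 - ?g \<omega>) / 2)"
    by (rule Bochner_Integration.integral_cong) (use pm in \<open>force simp: indicator_def\<close>)+
  also have "\<dots> = (1 - expectation ?g) / 2"
    using int by (simp add: prob_space)
  finally show ?thesis .
qed

end

section \<open>From the correlation inequality to sensitivity and stability\<close>

lemma symmetric_exclusion_processE:
  assumes "symmetric_exclusion_process M V E \<alpha> \<eta>" "finite_graph V E" "0 < \<alpha>"
  obtains T where "exclusion_process M V E \<alpha> T \<eta>"
  using assms unfolding symmetric_exclusion_process_def exclusion_process_def exclusion_clocks_def
    exclusion_clocks_axioms_def exclusion_process_axioms_def by blast

lemma prob_noisy_pair_neq:
  assumes V: "finite V" and f: "f \<in> configs V \<rightarrow> {-1, 1 :: real}"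
  shows "measure_pmf.prob (noisy_pair V \<epsilon>) {(\<omega>, \<omega>'). f \<omega> \<noteq> f \<omega>'}
       = (1 - measure_pmf.expectation (noisy_pair V \<epsilon>) (\<lambda>(\<omega>, \<omega>'). f \<omega> * f \<omega>')) / 2"
proof -
  let ?P = "noisy_pair V \<epsilon>"
  have supp: "set_pmf ?P \<subseteq> configs V \<times> configs V"
    using V unfolding noisy_pair_def
    by (auto simp: finite_configs configs_nonempty) (auto simp: configs_def)
  then have int: "integrable ?P g" for g :: "_ \<Rightarrow> real"
    using V by (intro integrable_measure_pmf_finite finite_subset[OF supp]) (simp add: finite_configs)
  have pm: "f \<omega> \<in> {-1, 1}" "f \<omega>' \<in> {-1, 1}" if "(\<omega>, \<omega>') \<in> set_pmf ?P" for \<omega> \<omega>'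
    using f supp that by blast+
  have "measure_pmf.prob ?P {(\<omega>, \<omega>'). f \<omega> \<noteq> f \<omega>'}
      = measure_pmf.expectation ?P (indicator {(\<omega>, \<omega>'). f \<omega> \<noteq> f \<omega>'})" by simp
  also have "\<dots> = measure_pmf.expectation ?P (\<lambda>(\<omega>, \<omega>'). (1 - f \<omega> * f \<omega>') / 2)"
    by (intro integral_cong_AE AE_pmfI) (use pm in \<open>force simp: indicator_def\<close>)+
  also have "(\<lambda>(\<omega>, \<omega>'). (1 - f \<omega> * f \<omega>') / 2) = (\<lambda>p. (1 - (case p of (\<omega>, \<omega>') \<Rightarrow> f \<omega> * f \<omega>')) / 2)"
    by auto
  also have "measure_pmf.expectation ?P \<dots> = (1 - measure_pmf.expectation ?P (\<lambda>(\<omega>, \<omega>'). f \<omega> * f \<omega>')) / 2"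
    by (simp add: Bochner_Integration.integral_diff[OF int int])
  finally show ?thesis .
qed

lemma parseval_sign:
  assumes V: "finite V" and f: "f \<in> configs V \<rightarrow> {-1, 1 :: real}"
  shows "(\<Sum>S\<in>Pow V. (fourier V f S)\<^sup>2) = 1"
proof -
  have "(\<Sum>\<omega>\<in>configs V. f \<omega> * f \<omega>) = (\<Sum>\<omega>\<in>configs V. 1)"
    by (intro sum.cong refl) (use f in force)
  then show ?thesis
    unfolding parseval[OF V, symmetric] expectation_configs[OF V] by (simp add: card_configs[OF V])
qed

text \<open>The empty set carries the squared mean with weight 1 whatever the noise level; removing
  it turns correlations into covariances.\<close>

lemma sum_Pow_remove_empty:
  fixes g :: "'a set \<Rightarrow> real"
  assumes "finite V"
  shows "(\<Sum>S\<in>Pow V. g S) = g {} + (\<Sum>S\<in>Pow V - {{}}. g S)"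
  using assms by (intro sum.remove) auto

text \<open>
  Weights of the form \<open>m ^ card S\<close> are compared by cutting at level \<open>k\<close>: below it the ratio to
  \<open>l ^ card S\<close> is bounded, above it the weight is uniformly small.
\<close>

lemma tendsto_geometric_weights:
  fixes c :: "nat \<Rightarrow> 'a set \<Rightarrow> real"
  assumes l: "0 < l" "l < 1" and m: "0 < m" "m < 1"
    and c: "\<And>n S. 0 \<le> c n S" and total: "\<And>n. (\<Sum>S\<in>A n. c n S) \<le> 1"
    and lim: "(\<lambda>n. \<Sum>S\<in>A n. l ^ card S * c n S) \<longlonglongrightarrow> 0"
  shows "(\<lambda>n. \<Sum>S\<in>A n. m ^ card S * c n S) \<longlonglongrightarrow> 0"
proof (rule LIMSEQ_I)
  fix r :: real assume r: "0 < r"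
  \<comment> \<open>The cut is chosen so that levels above \<open>k\<close> contribute less than
    half of \<open>r\<close>, their total mass being at most 1. With \<open>k\<close> fixed,
    \<open>l ^ k\<close> is a constant and the hypothesis handles the other half.\<close>
  obtain k where k: "m ^ k < r / 2"
    using real_arch_pow_inv[of "r / 2" m] r m by auto
  have weight: "m ^ j \<le> l ^ j / l ^ k + m ^ k" for j
  proof (cases "j \<le> k")
    case True
    have "m ^ j \<le> 1" using m by (simp add: power_le_one)
    also have "1 \<le> l ^ j / l ^ k"
      using l True by (simp add: power_decreasing)
    finally show ?thesis using m by (simp add: add_increasing2)
  next
    case False
    then have "m ^ j \<le> m ^ k" using m by (intro power_decreasing) auto
    then show ?thesis using l by (simp add: add_increasing)
  qed
  have bound: "(\<Sum>S\<in>A n. m ^ card S * c n S) \<le> (\<Sum>S\<in>A n. l ^ card S * c n S) / l ^ k + m ^ k" for n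
  proof -
    have "(\<Sum>S\<in>A n. m ^ card S * c n S) \<le> (\<Sum>S\<in>A n. (l ^ card S / l ^ k + m ^ k) * c n S)"
      by (intro sum_mono mult_right_mono weight c)
    also have "\<dots> = (\<Sum>S\<in>A n. l ^ card S * c n S) / l ^ k + m ^ k * (\<Sum>S\<in>A n. c n S)"
      by (simp add: distrib_right sum.distrib sum_divide_distrib sum_distrib_left)
    also have "m ^ k * (\<Sum>S\<in>A n. c n S) \<le> m ^ k"
      using mult_left_mono[OF total[of n], of "m ^ k"] m by simp
    finally show ?thesis by simp
  qed
  have "(\<lambda>n. (\<Sum>S\<in>A n. l ^ card S * c n S) / l ^ k) \<longlonglongrightarrow> 0 / l ^ k"
    by (intro tendsto_divide lim tendsto_const) (use l in simp)
  then have "\<forall>\<^sub>F n in sequentially. (\<Sum>S\<in>A n. l ^ card S * c n S) / l ^ k < r / 2"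
    using r by (intro order_tendstoD(2)) auto
  then obtain n0 where n0: "\<And>n. n \<ge> n0 \<Longrightarrow> (\<Sum>S\<in>A n. l ^ card S * c n S) / l ^ k < r / 2"
    by (auto simp: eventually_sequentially)
  show "\<exists>n0. \<forall>n\<ge>n0. norm ((\<Sum>S\<in>A n. m ^ card S * c n S) - 0) < r"
  proof (intro exI allI impI)
    fix n assume "n0 \<le> n"
    from n0[OF this] bound[of n] k have "(\<Sum>S\<in>A n. m ^ card S * c n S) < r" by linarith
    moreover have "0 \<le> (\<Sum>S\<in>A n. m ^ card S * c n S)"
      using m c by (intro sum_nonneg) auto
    ultimately show "norm ((\<Sum>S\<in>A n. m ^ card S * c n S) - 0) < r" by simp
  qed
qed

theorem theorem1p12:
  fixes V :: "nat \<Rightarrow> 'a set"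
    and f :: "nat \<Rightarrow> ('a \<Rightarrow> bool) \<Rightarrow> real"
  assumes "\<And>n. finite (V n)"
    and "incseq V"
    and "\<And>n. f n \<in> configs (V n) \<rightarrow> {-1, 1}"
  shows "((\<exists>(E :: nat \<Rightarrow> 'a set set) (\<alpha> :: nat \<Rightarrow> real) (M :: nat \<Rightarrow> 'w measure) \<eta>.
             admissible V E \<alpha> \<and>
             (\<forall>n. symmetric_exclusion_process (M n) (V n) (E n) (\<alpha> n) (\<eta> n)) \<and>
             XS M \<eta> f)
          \<longrightarrow> NS V f)
       \<and> (NStable V f \<longrightarrow>
          (\<forall>(E :: nat \<Rightarrow> 'a set set) (\<alpha> :: nat \<Rightarrow> real) (M :: nat \<Rightarrow> 'w measure) \<eta>.
             admissible V E \<alpha> \<and>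
             (\<forall>n. symmetric_exclusion_process (M n) (V n) (E n) (\<alpha> n) (\<eta> n))
             \<longrightarrow> XStable M \<eta> f))"
proof (intro conjI impI allI)
  let ?a = "\<lambda>n. fourier (V n) (f n)"
  let ?A = "\<lambda>n. Pow (V n) - {{}}"
  let ?E = "\<lambda>n. measure_pmf.expectation (pmf_of_set (configs (V n))) (f n)"
  assume "\<exists>(E :: nat \<Rightarrow> 'a set set) (\<alpha> :: nat \<Rightarrow> real) (M :: nat \<Rightarrow> 'w measure) \<eta>.
             admissible V E \<alpha> \<and>
             (\<forall>n. symmetric_exclusion_process (M n) (V n) (E n) (\<alpha> n) (\<eta> n)) \<and> XS M \<eta> f"
  then obtain E \<alpha> and M :: "nat \<Rightarrow> 'w measure" and \<eta> where adm: "admissible V E \<alpha>"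
    and sep: "\<And>n. symmetric_exclusion_process (M n) (V n) (E n) (\<alpha> n) (\<eta> n)"
    and XS: "XS M \<eta> f"
    by blast
  from XS obtain t where t: "0 < t" and
    cov: "(\<lambda>n. prob_space.expectation (M n) (\<lambda>\<omega>. f n (\<eta> n 0 \<omega>) * f n (\<eta> n t \<omega>))
          - (prob_space.expectation (M n) (\<lambda>\<omega>. f n (\<eta> n 0 \<omega>)))\<^sup>2) \<longlonglongrightarrow> 0"
    unfolding XS_def by blast
  let ?l = "exp (- (2 * t))"
  \<comment> \<open>The noise covariance at parameter \<open>1 - ?l\<close> is squeezed between 0
    and the exclusion covariance at the one time \<open>t\<close> supplied by
    \<open>XS\<close>.\<close>
  have nonempty: "(\<lambda>n. \<Sum>S\<in>?A n. ?l ^ card S * (?a n S)\<^sup>2) \<longlonglongrightarrow> 0"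
  proof (rule tendsto_sandwich[OF _ _ tendsto_const cov])
    show "\<forall>\<^sub>F n in sequentially. 0 \<le> (\<Sum>S\<in>?A n. ?l ^ card S * (?a n S)\<^sup>2)"
      by (intro always_eventually allI sum_nonneg) simp
    show "\<forall>\<^sub>F n in sequentially. (\<Sum>S\<in>?A n. ?l ^ card S * (?a n S)\<^sup>2)
        \<le> prob_space.expectation (M n) (\<lambda>\<omega>. f n (\<eta> n 0 \<omega>) * f n (\<eta> n t \<omega>))
          - (prob_space.expectation (M n) (\<lambda>\<omega>. f n (\<eta> n 0 \<omega>)))\<^sup>2"
    proof (intro always_eventually allI)
      fix n
      obtain T where "exclusion_process (M n) (V n) (E n) (\<alpha> n) T (\<eta> n)"
        using symmetric_exclusion_processE[OF sep] adm unfolding admissible_def by metis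
      then interpret exclusion_process "M n" "V n" "E n" "\<alpha> n" T "\<eta> n" .
      have "(\<Sum>S\<in>Pow (V n). ?l ^ card S * (?a n S)\<^sup>2) \<le> expectation (\<lambda>\<omega>. f n (\<eta> n 0 \<omega>) * f n (\<eta> n t \<omega>))"
        by (rule expectation_process_ge[OF assms(3) t]) (use adm in \<open>simp add: admissible_def\<close>)
      then show "(\<Sum>S\<in>?A n. ?l ^ card S * (?a n S)\<^sup>2)
        \<le> expectation (\<lambda>\<omega>. f n (\<eta> n 0 \<omega>) * f n (\<eta> n t \<omega>))
          - (expectation (\<lambda>\<omega>. f n (\<eta> n 0 \<omega>)))\<^sup>2"
        by (simp add: sum_Pow_remove_empty[OF assms(1)] expectation_initial fourier_empty)
    qed
  qed
  show "NS V f"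
    unfolding NS_def
  proof (intro allI impI)
    fix \<epsilon> :: real assume \<epsilon>: "0 < \<epsilon> \<and> \<epsilon> < 1"
    \<comment> \<open>Decay for the single weight \<open>?l\<close> passes to every noise level, the
      total mass being at most 1 by Parseval.\<close>
    have "(\<lambda>n. \<Sum>S\<in>?A n. (1 - \<epsilon>) ^ card S * (?a n S)\<^sup>2) \<longlonglongrightarrow> 0"
    proof (rule tendsto_geometric_weights[OF _ _ _ _ _ _ nonempty])
      show "(\<Sum>S\<in>?A n. (?a n S)\<^sup>2) \<le> 1" for n
        using parseval_sign[OF assms(1,3), of n] zero_le_power2[of "?a n {}"]
        unfolding sum_Pow_remove_empty[OF assms(1)] by linarith
    qed (use t \<epsilon> in auto)
    also have "(\<lambda>n. \<Sum>S\<in>?A n. (1 - \<epsilon>) ^ card S * (?a n S)\<^sup>2)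
        = (\<lambda>n. measure_pmf.expectation (noisy_pair (V n) \<epsilon>) (\<lambda>(\<omega>, \<omega>'). f n \<omega> * f n \<omega>') - (?E n)\<^sup>2)"
      using \<epsilon> by (simp add: noisy_pair_fourier[OF assms(1)] sum_Pow_remove_empty[OF assms(1)] fourier_empty)
    finally show "(\<lambda>n. measure_pmf.expectation (noisy_pair (V n) \<epsilon>) (\<lambda>(\<omega>, \<omega>'). f n \<omega> * f n \<omega>')
        - (?E n)\<^sup>2) \<longlonglongrightarrow> 0" .
  qed
next
  fix E :: "nat \<Rightarrow> 'a set set" and \<alpha> :: "nat \<Rightarrow> real" and M :: "nat \<Rightarrow> 'w measure" and \<eta>
  assume NStable: "NStable V f"
    and "admissible V E \<alpha> \<and> (\<forall>n. symmetric_exclusion_process (M n) (V n) (E n) (\<alpha> n) (\<eta> n))"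
  then have adm: "admissible V E \<alpha>"
    and sep: "\<And>n. symmetric_exclusion_process (M n) (V n) (E n) (\<alpha> n) (\<eta> n)"
    by blast+
  show "XStable M \<eta> f"
    unfolding XStable_def
  proof (intro allI impI)
    fix \<delta> :: real assume "0 < \<delta>"
    with NStable obtain \<epsilon> where \<epsilon>: "0 < \<epsilon>" "\<epsilon> < 1"
      and le: "\<And>n. measure_pmf.prob (noisy_pair (V n) \<epsilon>) {(\<omega>, \<omega>'). f n \<omega> \<noteq> f n \<omega>'} \<le> \<delta>"
      unfolding NStable_def by blast
    \<comment> \<open>The time at which the exclusion bound matches noise level
      \<open>\<epsilon>\<close>; it is the same for all \<open>n\<close>, as uniform stability
      demands.\<close>
    define t where "t = - ln (1 - \<epsilon>) / 2"
    have t: "0 < t" "exp (- (2 * t)) = 1 - \<epsilon>"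
      using \<epsilon> by (auto simp: t_def)
    have "measure (M n) {\<omega> \<in> space (M n). f n (\<eta> n 0 \<omega>) \<noteq> f n (\<eta> n t \<omega>)} \<le> \<delta>" for n
    proof -
      obtain T where "exclusion_process (M n) (V n) (E n) (\<alpha> n) T (\<eta> n)"
        using symmetric_exclusion_processE[OF sep] adm unfolding admissible_def by metis
      then interpret exclusion_process "M n" "V n" "E n" "\<alpha> n" T "\<eta> n" .
      have "(\<Sum>S\<in>Pow (V n). exp (- (2 * t)) ^ card S * (fourier (V n) (f n) S)\<^sup>2)
          \<le> expectation (\<lambda>\<omega>. f n (\<eta> n 0 \<omega>) * f n (\<eta> n t \<omega>))"
        by (rule expectation_process_ge[OF assms(3) t(1)]) (use adm in \<open>simp add: admissible_def\<close>)
      \<comment> \<open>A larger correlation means a smaller disagreement probability, so the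
        exclusion process at time \<open>t\<close> changes the value no more often than the
        noise.\<close>
      then have "prob {\<omega> \<in> space (M n). f n (\<eta> n 0 \<omega>) \<noteq> f n (\<eta> n t \<omega>)}
          \<le> measure_pmf.prob (noisy_pair (V n) \<epsilon>) {(\<omega>, \<omega>'). f n \<omega> \<noteq> f n \<omega>'}"
        using \<epsilon> by (simp add: prob_process_neq[OF assms(3) t(1)] prob_noisy_pair_neq[OF assms(1,3)]
            noisy_pair_fourier[OF assms(1)] t(2))
      with le[of n] show ?thesis by linarith
    qed
    with t(1) show "\<exists>t>0. \<forall>n. measure (M n) {\<omega> \<in> space (M n). f n (\<eta> n 0 \<omega>) \<noteq> f n (\<eta> n t \<omega>)} \<le> \<delta>"
      by blast
  qed
qed

end
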